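(* Of the 46 two-colour wallpaper groups, exactly 17 are compatible with periodic generalized hitomezashi patterns (PGHPs). These types are: $p1/p1$, $p2/p1$, $p2/p2$, $pm/pm(m)$, $pm/cm$, $pg/p1$, $pg/pg$, $pmg/pm$, $pmg/pmg$, $cm/pm$, $cm/pg$, $cm/p1$, $cmm/pmm$, $cmm/pmg$, $cmm/cm$, $p4m/pmm$, and $p4m/p4m$.
   Context: PGHPs. Let $x=(x_i)_{i\in\mathbb Z}$ and $y=(y_j)_{j\in\mathbb Z}$ be periodic bi-infinite binary words. The PGHP generated by $(x,y)$ is the following design on the unit square grid with vertices $\mathbb Z^2$: the vertical unit edge from $(i,j)$ to $(i,j+1)$ is a front stitch if $x_i+j$ is odd and a back stitch otherwise; the horizontal unit edge from $(i,j)$ to $(i+1,j)$ is a front stitch if $y_j+i$ is odd and a back stitch otherwise (so stitches alternate front/back along every gridline). A symmetry is an isometry of the plane mapping front stitches onto front stitches and back stitches onto back stitches (colour-preserving); a flip-symmetry is an isometry of the plane mapping front stitches onto back stitches and back stitches onto front stitches (colour-reversing). Two-colour wallpaper groups. Wallpaper groups are denoted by the short crystallographic notation ($p1,p2,pm,pg,cm,pmm,pmg,pgg,cmm,p4,p4m,p4g,p3,p3m1,p31m,p6,p6m$). A two-colour wallpaper group is denoted $T/T'$, where $T$ is the type of the group of all isometries consistent with colour (preserving or reversing), and $T'$ is the type of the subgroup (of index 2) of colour-preserving isometries. This notation identifies the type uniquely, except for $pm/pm$, which comprises two types: $pm/pm(m')$, having colour-reversing reflections, and $pm/pm(m)$,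 having none. The 46 types are: $p1/p1$, $p2/p1$, $p2/p2$, $pm/p1$, $pm/pm(m')$, $pm/pg$, $pm/pm(m)$, $pm/cm$, $pg/p1$, $pg/pg$, $pmm/pm$, $pmm/p2$, $pmm/pmg$, $pmm/pmm$, $pmm/cmm$, $pmg/pm$, $pmg/pg$, $pmg/p2$, $pmg/pgg$, $pmg/pmg$, $pgg/pg$, $pgg/p2$, $cm/pm$, $cm/pg$, $cm/p1$, $cmm/pgg$, $cmm/pmm$, $cmm/pmg$, $cmm/cm$, $cmm/p2$, $p4/p2$, $p4/p4$, $p4m/cmm$, $p4m/pmm$, $p4m/p4$, $p4m/p4m$, $p4m/p4g$, $p4g/pgg$, $p4g/cmm$, $p4g/p4$, $p31m/p3$, $p3m1/p3$, $p6/p3$, $p6m/p3m1$, $p6m/p31m$, $p6m/p6$. The type $T/T'$ is compatible with PGHPs if there is a PGHP having at least one flip-symmetry, whose group of all symmetries and flip-symmetries together with its index-2 subgroup of (colour-preserving) symmetries is of type $T/T'$; otherwise it is incompatible. *)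

theory Defs
  imports "HOL-Analysis.Analysis"
begin

section \<open>Wallpaper group types\<close>

type_synonym plane = "real \<times> real"

definition isometry :: "(plane \<Rightarrow> plane) \<Rightarrow> bool" where
  "isometry f \<longleftrightarrow> (\<forall>p q. dist (f p) (f q) = dist p q)"

datatype wallpaper_type =
  P1 | P2 | PM | PG | CM | PMM | PMG | PGG | CMM | P4 | P4M | P4G | P3 | P3M1 | P31M | P6 | P6M

text \<open>
  The general positions of the International Tables for Crystallography, in coordinates with
  respect to the conventional cell: the elements of a group of the given type modulo integer
  translations. For the hexagonal types the two basis vectors enclose an angle of 120 degrees, so
  in these coordinates the maps are affine but not isometries. The centred types \<open>CM\<close> and \<open>CMM\<close>
  include the centring translation.
\<close>

primrec general_positions :: "wallpaper_type \<Rightarrow> (plane \<Rightarrow> plane) set" where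
  "general_positions P1 = {\<lambda>(x, y). (x, y)}"
| "general_positions P2 = {\<lambda>(x, y). (x, y), \<lambda>(x, y). (- x, - y)}"
| "general_positions PM = {\<lambda>(x, y). (x, y), \<lambda>(x, y). (- x, y)}"
| "general_positions PG = {\<lambda>(x, y). (x, y), \<lambda>(x, y). (- x, y + 1/2)}"
| "general_positions CM =
    {\<lambda>(x, y). (x, y), \<lambda>(x, y). (- x, y),
     \<lambda>(x, y). (x + 1/2, y + 1/2), \<lambda>(x, y). (- x + 1/2, y + 1/2)}"
| "general_positions PMM =
    {\<lambda>(x, y). (x, y), \<lambda>(x, y). (- x, - y), \<lambda>(x, y). (- x, y), \<lambda>(x, y). (x, - y)}"
| "general_positions PMG =
    {\<lambda>(x, y). (x, y), \<lambda>(x, y). (- x, - y),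
     \<lambda>(x, y). (- x + 1/2, y), \<lambda>(x, y). (x + 1/2, - y)}"
| "general_positions PGG =
    {\<lambda>(x, y). (x, y), \<lambda>(x, y). (- x, - y),
     \<lambda>(x, y). (- x + 1/2, y + 1/2), \<lambda>(x, y). (x + 1/2, - y + 1/2)}"
| "general_positions CMM =
    {\<lambda>(x, y). (x, y), \<lambda>(x, y). (- x, - y), \<lambda>(x, y). (- x, y), \<lambda>(x, y). (x, - y),
     \<lambda>(x, y). (x + 1/2, y + 1/2), \<lambda>(x, y). (- x + 1/2, - y + 1/2),
     \<lambda>(x, y). (- x + 1/2, y + 1/2), \<lambda>(x, y). (x + 1/2, - y + 1/2)}"
| "general_positions P4 =
    {\<lambda>(x, y). (x, y), \<lambda>(x, y). (- x, - y), \<lambda>(x, y). (- y, x), \<lambda>(x, y). (y, - x)}"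
| "general_positions P4M =
    {\<lambda>(x, y). (x, y), \<lambda>(x, y). (- x, - y), \<lambda>(x, y). (- y, x), \<lambda>(x, y). (y, - x),
     \<lambda>(x, y). (- x, y), \<lambda>(x, y). (x, - y), \<lambda>(x, y). (y, x), \<lambda>(x, y). (- y, - x)}"
| "general_positions P4G =
    {\<lambda>(x, y). (x, y), \<lambda>(x, y). (- x, - y), \<lambda>(x, y). (- y, x), \<lambda>(x, y). (y, - x),
     \<lambda>(x, y). (- x + 1/2, y + 1/2), \<lambda>(x, y). (x + 1/2, - y + 1/2),
     \<lambda>(x, y). (y + 1/2, x + 1/2), \<lambda>(x, y). (- y + 1/2, - x + 1/2)}"
| "general_positions P3 =
    {\<lambda>(x, y). (x, y), \<lambda>(x, y). (- y, x - y), \<lambda>(x, y). (- x + y, - x)}"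
| "general_positions P3M1 =
    {\<lambda>(x, y). (x, y), \<lambda>(x, y). (- y, x - y), \<lambda>(x, y). (- x + y, - x),
     \<lambda>(x, y). (- y, - x), \<lambda>(x, y). (- x + y, y), \<lambda>(x, y). (x, x - y)}"
| "general_positions P31M =
    {\<lambda>(x, y). (x, y), \<lambda>(x, y). (- y, x - y), \<lambda>(x, y). (- x + y, - x),
     \<lambda>(x, y). (y, x), \<lambda>(x, y). (x - y, - y), \<lambda>(x, y). (- x, - x + y)}"
| "general_positions P6 =
    {\<lambda>(x, y). (x, y), \<lambda>(x, y). (- y, x - y), \<lambda>(x, y). (- x + y, - x),
     \<lambda>(x, y). (- x, - y), \<lambda>(x, y). (y, - x + y), \<lambda>(x, y). (x - y, x)}"
| "general_positions P6M =
    {\<lambda>(x, y). (x, y), \<lambda>(x, y). (- y, x - y), \<lambda>(x, y). (- x + y, - x),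
     \<lambda>(x, y). (- x, - y), \<lambda>(x, y). (y, - x + y), \<lambda>(x, y). (x - y, x),
     \<lambda>(x, y). (- y, - x), \<lambda>(x, y). (- x + y, y), \<lambda>(x, y). (x, x - y),
     \<lambda>(x, y). (y, x), \<lambda>(x, y). (x - y, - y), \<lambda>(x, y). (- x, - x + y)}"

definition standard_group :: "wallpaper_type \<Rightarrow> (plane \<Rightarrow> plane) set" where
  "standard_group T =
    {\<lambda>p. g p + (real_of_int m, real_of_int n) | g m n. g \<in> general_positions T}"

definition affine_bijection :: "(plane \<Rightarrow> plane) \<Rightarrow> bool" where
  "affine_bijection \<phi> \<longleftrightarrow> (\<exists>L b. linear L \<and> bij L \<and> \<phi> = (\<lambda>p. L p + b))"

text \<open>
  Two wallpaper groups have the same type iff they are conjugate under an affine bijection of the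
  plane; \<open>\<phi>\<close> is the passage from cell coordinates to the Euclidean plane.
\<close>

definition has_type :: "(plane \<Rightarrow> plane) set \<Rightarrow> wallpaper_type \<Rightarrow> bool" where
  "has_type G T \<longleftrightarrow>
    (\<exists>\<phi>. affine_bijection \<phi> \<and> G = {\<phi> \<circ> g \<circ> inv \<phi> | g. g \<in> standard_group T})"


section \<open>Two-colour wallpaper group types\<close>

text \<open>
  \<open>Two_Colour T T'\<close> stands for $T/T'$. The two types written $pm/pm$ have separate constructors, and
  \<open>Two_Colour PM PM\<close> is not used.
\<close>

datatype two_colour_type =
  Two_Colour wallpaper_type wallpaper_type
| PM_PM_m'
| PM_PM_m

definition two_colour_types :: "two_colour_type set" where
  "two_colour_types =
    {Two_Colour P1 P1, Two_Colour P2 P1, Two_Colour P2 P2,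
     Two_Colour PM P1, PM_PM_m', Two_Colour PM PG, PM_PM_m, Two_Colour PM CM,
     Two_Colour PG P1, Two_Colour PG PG,
     Two_Colour PMM PM, Two_Colour PMM P2, Two_Colour PMM PMG, Two_Colour PMM PMM,
     Two_Colour PMM CMM,
     Two_Colour PMG PM, Two_Colour PMG PG, Two_Colour PMG P2, Two_Colour PMG PGG,
     Two_Colour PMG PMG,
     Two_Colour PGG PG, Two_Colour PGG P2,
     Two_Colour CM PM, Two_Colour CM PG, Two_Colour CM P1,
     Two_Colour CMM PGG, Two_Colour CMM PMM, Two_Colour CMM PMG, Two_Colour CMM CM,
     Two_Colour CMM P2,
     Two_Colour P4 P2, Two_Colour P4 P4,
     Two_Colour P4M CMM, Two_Colour P4M PMM, Two_Colour P4M P4, Two_Colour P4M P4M,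
     Two_Colour P4M P4G,
     Two_Colour P4G PGG, Two_Colour P4G CMM, Two_Colour P4G P4,
     Two_Colour P31M P3, Two_Colour P3M1 P3,
     Two_Colour P6 P3, Two_Colour P6M P3M1, Two_Colour P6M P31M, Two_Colour P6M P6}"

text \<open>The axis of the reflection is the line through \<open>a\<close> orthogonal to \<open>v\<close>.\<close>

definition line_reflection :: "(plane \<Rightarrow> plane) \<Rightarrow> bool" where
  "line_reflection f \<longleftrightarrow> (\<exists>a v. v \<noteq> 0 \<and> f = (\<lambda>p. p - (2 * ((p - a) \<bullet> v) / (v \<bullet> v)) *\<^sub>R v))"

text \<open>
  The two-colour group is given by its set \<open>S\<close> of colour-preserving and its set \<open>F\<close> of
  colour-reversing isometries.
\<close>

primrec has_two_colour_type ::
  "(plane \<Rightarrow> plane) set \<Rightarrow> (plane \<Rightarrow> plane) set \<Rightarrow> two_colour_type \<Rightarrow> bool" where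
  "has_two_colour_type S F (Two_Colour T T') \<longleftrightarrow> has_type (S \<union> F) T \<and> has_type S T'"
| "has_two_colour_type S F PM_PM_m' \<longleftrightarrow>
    has_type (S \<union> F) PM \<and> has_type S PM \<and> (\<exists>f\<in>F. line_reflection f)"
| "has_two_colour_type S F PM_PM_m \<longleftrightarrow>
    has_type (S \<union> F) PM \<and> has_type S PM \<and> \<not> (\<exists>f\<in>F. line_reflection f)"


section \<open>Periodic generalized hitomezashi patterns\<close>

definition periodic_binary_word :: "(int \<Rightarrow> int) \<Rightarrow> bool" where
  "periodic_binary_word x \<longleftrightarrow> (\<forall>i. x i \<in> {0, 1}) \<and> (\<exists>n>0. \<forall>i. x (i + n) = x i)"

definition vertex :: "int \<Rightarrow> int \<Rightarrow> plane" where
  "vertex i j = (real_of_int i, real_of_int j)"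

definition vertical_edge :: "int \<Rightarrow> int \<Rightarrow> plane set" where
  "vertical_edge i j = closed_segment (vertex i j) (vertex i (j + 1))"

definition horizontal_edge :: "int \<Rightarrow> int \<Rightarrow> plane set" where
  "horizontal_edge i j = closed_segment (vertex i j) (vertex (i + 1) j)"

definition front_stitches :: "(int \<Rightarrow> int) \<Rightarrow> (int \<Rightarrow> int) \<Rightarrow> plane set set" where
  "front_stitches x y =
    {vertical_edge i j | i j. odd (x i + j)} \<union> {horizontal_edge i j | i j. odd (y j + i)}"

definition back_stitches :: "(int \<Rightarrow> int) \<Rightarrow> (int \<Rightarrow> int) \<Rightarrow> plane set set" where
  "back_stitches x y =
    {vertical_edge i j | i j. \<not> odd (x i + j)} \<union> {horizontal_edge i j | i j. \<not> odd (y j + i)}"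

definition symmetries :: "(int \<Rightarrow> int) \<Rightarrow> (int \<Rightarrow> int) \<Rightarrow> (plane \<Rightarrow> plane) set" where
  "symmetries x y =
    {f. isometry f \<and> (\<lambda>s. f ` s) ` front_stitches x y = front_stitches x y
                   \<and> (\<lambda>s. f ` s) ` back_stitches x y = back_stitches x y}"

definition flip_symmetries :: "(int \<Rightarrow> int) \<Rightarrow> (int \<Rightarrow> int) \<Rightarrow> (plane \<Rightarrow> plane) set" where
  "flip_symmetries x y =
    {f. isometry f \<and> (\<lambda>s. f ` s) ` front_stitches x y = back_stitches x y
                   \<and> (\<lambda>s. f ` s) ` back_stitches x y = front_stitches x y}"

definition compatible :: "two_colour_type \<Rightarrow> bool" where
  "compatible \<tau> \<longleftrightarrow>
    (\<exists>x y. periodic_binary_word x \<and> periodic_binary_word y \<and>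
           flip_symmetries x y \<noteq> {} \<and>
           has_two_colour_type (symmetries x y) (flip_symmetries x y) \<tau>)"

end

theory Submission
  imports Defs
begin

text \<open>
  An isometry that carries stitches to stitches is a signed permutation of the coordinates followed
  by an integer translation, and its effect on colours is a pair of parity conditions on the words.

  For the excluded types, these conditions say that an axis-parallel reflection always preserves
  colours, that a quarter turn forces an axis-parallel reflection, and that a half turn together with
  any further isometry that is not a translation or half turn forces a colour-preserving reflection.
  Moreover, a colour-preserving translation \<open>(h, \<plusminus>h)\<close> forces the translation \<open>(h, 0)\<close>, so that in a
  rectangular lattice whose sides are diagonal to the grid both generators reverse colours. Each
  excluded type contradicts one of these facts, through properties that survive conjugation by an
  affine bijection. Each remaining type is realised by an explicit pair of words.
\<close>

section \<open>Stitch isometries as parity conditions\<close>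

text \<open>A stitch isometry imposes one condition on each word, and the two are tied together only
  by parities. One condition can therefore be kept and completed by the trivial one, that a word
  agrees with itself, whenever the parities fit; forced reflections and translations arise in this
  way. A half turn alone leaves the parities open, whereas a second isometry or a quarter turn
  squaring to it pins them down.

  An axis-parallel reflection preserves colours because it fixes a stitch: its axis is a gridline or
  bisects the stitches that it crosses. A diagonal reflection fixes no stitch and may have either
  effect, so pm, pmm and p4m have to be excluded separately for the two positions of their cells.

  Reflections are recognised as involutions, perpendicular mirrors by their product being a half
  turn, and rectangular lattices by the action of a linear part.\<close>

definition aff :: "real \<Rightarrow> real \<Rightarrow> real \<Rightarrow> real \<Rightarrow> real \<Rightarrow> real \<Rightarrow> plane \<Rightarrow> plane" where
  "aff p q r s a b = (\<lambda>(x, y). (p * x + q * y + a, r * x + s * y + b))"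

lemma aff_apply [simp]: "aff p q r s a b (x, y) = (p * x + q * y + a, r * x + s * y + b)"
  by (simp add: aff_def)

lemma aff_eq_iff [simp]:
  "aff p q r s a b = aff p' q' r' s' a' b' \<longleftrightarrow>
    p = p' \<and> q = q' \<and> r = r' \<and> s = s' \<and> a = a' \<and> b = b'"
proof
  assume eq: "aff p q r s a b = aff p' q' r' s' a' b'"
  from fun_cong[OF eq, of "(0, 0)"] fun_cong[OF eq, of "(1, 0)"] fun_cong[OF eq, of "(0, 1)"]
  show "p = p' \<and> q = q' \<and> r = r' \<and> s = s' \<and> a = a' \<and> b = b'" by simp
qed simp

lemma aff_comp [simp]:
  "aff p q r s a b \<circ> aff p' q' r' s' a' b' =
    aff (p * p' + q * r') (p * q' + q * s') (r * p' + s * r') (r * q' + s * s')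
      (p * a' + q * b' + a) (r * a' + s * b' + b)"
  by (auto simp: fun_eq_iff algebra_simps)

lemma aff_image_segment:
  "aff p q r s a b ` closed_segment u v = closed_segment (aff p q r s a b u) (aff p q r s a b v)"
proof -
  have aff: "aff p q r s a b = (\<lambda>z. (a, b) + z) \<circ> aff p q r s 0 0"
    by (auto simp: fun_eq_iff)
  have "linear (aff p q r s 0 0)"
    by (rule linearI) (auto simp: algebra_simps aff_def split: prod.splits)
  from closed_segment_linear_image[OF this, of u v] show ?thesis
    by (simp only: aff image_comp[symmetric] o_apply closed_segment_translation)
qed

definition unit_signs :: "int set" where "unit_signs = {1, - 1}"

definition grid_map :: "bool \<Rightarrow> int \<Rightarrow> int \<Rightarrow> int \<Rightarrow> int \<Rightarrow> plane \<Rightarrow> plane" where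
  "grid_map sw s t a b =
    (if sw then aff 0 (of_int s) (of_int t) 0 (of_int a) (of_int b)
     else aff (of_int s) 0 0 (of_int t) (of_int a) (of_int b))"

definition edge :: "bool \<times> int \<times> int \<Rightarrow> plane set" where
  "edge = (\<lambda>(v, i, j). if v then vertical_edge i j else horizontal_edge i j)"

lemma edge_eq_iff [simp]: "edge k = edge k' \<longleftrightarrow> k = k'"
  by (cases k; cases k') 
   (auto simp: edge_def vertical_edge_def horizontal_edge_def vertex_def closed_segment_eq doubleton_eq_iff)

text \<open>
  An edge is named by its lower or left endpoint, which after a reflection is the image of the other
  endpoint; hence the subtraction of 1.
\<close>

definition edge_perm :: "bool \<Rightarrow> int \<Rightarrow> int \<Rightarrow> int \<Rightarrow> int \<Rightarrow> bool \<times> int \<times> int \<Rightarrow> bool \<times> int \<times> int" where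
  "edge_perm sw s t a b = (\<lambda>(v, i, j).
    let (i', j') = (if sw then (s * j + a, t * i + b) else (s * i + a, t * j + b));
        v' = (v \<noteq> sw)
    in (v', if \<not> v' \<and> s = - 1 then i' - 1 else i', if v' \<and> t = - 1 then j' - 1 else j'))"

lemma grid_map_edge:
  assumes "s \<in> unit_signs" "t \<in> unit_signs"
  shows "grid_map sw s t a b ` edge k = edge (edge_perm sw s t a b k)"
  using assms
  by (cases k)
    (auto simp: unit_signs_def grid_map_def edge_perm_def edge_def vertical_edge_def
      horizontal_edge_def vertex_def aff_image_segment closed_segment_commute algebra_simps
      closed_segment_eq doubleton_eq_iff)

lemma edge_perm_surj:
  assumes "s \<in> unit_signs" "t \<in> unit_signs"
  shows "\<exists>k'. edge_perm sw s t a b k' = k"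
proof -
  obtain v i j where k: "k = (v, i, j)" by (cases k)
  \<comment> \<open>The 1 subtracted by \<open>edge_perm\<close> is added back in the coordinate
    that runs along the edge \<open>k\<close>.\<close>
  define i' where "i' = (if \<not> v \<and> s = - 1 then i + 1 else i)"
  define j' where "j' = (if v \<and> t = - 1 then j + 1 else j)"
  have "edge_perm sw s t a b (v \<noteq> sw, if sw then (t * (j' - b), s * (i' - a)) else (s * (i' - a), t * (j' - b))) = k"
    using assms by (auto simp: k edge_perm_def unit_signs_def i'_def j'_def)
  then show ?thesis ..
qed

text \<open>An integer read modulo 2, odd meaning front: comparing colours becomes the parity of a
  sum, and reversing them becomes adding 1.\<close>

definition colour :: "(int \<Rightarrow> int) \<Rightarrow> (int \<Rightarrow> int) \<Rightarrow> bool \<times> int \<times> int \<Rightarrow> int" where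
  "colour x y = (\<lambda>(v, i, j). if v then x i + j else y j + i)"

lemma stitches_colour_aux:
  "{vertical_edge i j | i j. P (x i + j)} \<union> {horizontal_edge i j | i j. P (y j + i)}
    = edge ` {k. P (colour x y k)}" (is "?l = ?r")
proof
  have "vertical_edge i j \<in> ?r" if "P (x i + j)" for i j
    using that by (intro image_eqI[of _ _ "(True, i, j)"]) (auto simp: edge_def colour_def)
  moreover have "horizontal_edge i j \<in> ?r" if "P (y j + i)" for i j
    using that by (intro image_eqI[of _ _ "(False, i, j)"]) (auto simp: edge_def colour_def)
  ultimately show "?l \<subseteq> ?r" by blast
  show "?r \<subseteq> ?l"
  proof
    fix u assume "u \<in> ?r"
    then obtain v i j where "u = edge (v, i, j)" "P (colour x y (v, i, j))" by auto
    then show "u \<in> ?l"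
      by (cases v) (auto simp: edge_def colour_def)
  qed
qed

lemma front_stitches_colour: "front_stitches x y = edge ` {k. odd (colour x y k)}"
  unfolding front_stitches_def by (rule stitches_colour_aux)

lemma back_stitches_colour: "back_stitches x y = edge ` {k. even (colour x y k)}"
  using stitches_colour_aux[of "\<lambda>n. \<not> odd n" x y] by (simp add: back_stitches_def)

text \<open>\<open>d\<close> selects the set that is mapped, front stitches if even and back
  stitches if odd, and \<open>e\<close> is the effect on colours. Being added on both sides,
  \<open>d\<close> drops out, so one condition governs both sets.\<close>

lemma grid_map_stitches:
  assumes st: "s \<in> unit_signs" "t \<in> unit_signs"
  shows "(\<lambda>u. grid_map sw s t a b ` u) ` edge ` {k. odd (colour x y k + d)}
      = edge ` {k. odd (colour x y k + d + e)} \<longleftrightarrow>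
    (\<forall>k. even (colour x y k + colour x y (edge_perm sw s t a b k) + e))"
    (is "?l = ?r \<longleftrightarrow> _")
proof -
  let ?p = "edge_perm sw s t a b"
  have inj: "k = k'" if "?p k = ?p k'" for k k'
  proof -
    have "inj (grid_map sw s t a b)"
      using st by (auto simp: grid_map_def unit_signs_def inj_def)
    then show ?thesis
      using grid_map_edge[OF st, of sw a b k] grid_map_edge[OF st, of sw a b k'] that
      by (metis edge_eq_iff inj_image_eq_iff)
  qed
  have "?l = edge ` ?p ` {k. odd (colour x y k + d)}"
    by (simp add: image_image grid_map_edge[OF st])
  moreover have "edge ` A = edge ` B \<longleftrightarrow> A = B" for A B
    by (rule inj_image_eq_iff) (simp add: inj_def)
  ultimately have "?l = ?r \<longleftrightarrow> ?p ` {k. odd (colour x y k + d)} = {k. odd (colour x y k + d + e)}"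
    by metis
  also have "\<dots> \<longleftrightarrow> (\<forall>k. odd (colour x y k + d) \<longleftrightarrow> odd (colour x y (?p k) + d + e))"
  proof
    assume eq: "?p ` {k. odd (colour x y k + d)} = {k. odd (colour x y k + d + e)}"
    show "\<forall>k. odd (colour x y k + d) \<longleftrightarrow> odd (colour x y (?p k) + d + e)"
    proof
      fix k
      have "odd (colour x y (?p k) + d + e) \<longleftrightarrow> ?p k \<in> ?p ` {k. odd (colour x y k + d)}"
        using eq by simp
      also have "\<dots> \<longleftrightarrow> odd (colour x y k + d)" using inj by blast
      finally show "odd (colour x y k + d) \<longleftrightarrow> odd (colour x y (?p k) + d + e)" by simp
    qed
  next
    assume "\<forall>k. odd (colour x y k + d) \<longleftrightarrow> odd (colour x y (?p k) + d + e)"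
    then have *: "odd (colour x y (?p k) + d + e) \<longleftrightarrow> odd (colour x y k + d)" for k by blast
    show "?p ` {k. odd (colour x y k + d)} = {k. odd (colour x y k + d + e)}"
    proof (intro equalityI subsetI)
      fix k assume "k \<in> {k. odd (colour x y k + d + e)}"
      moreover obtain k' where "?p k' = k" using edge_perm_surj[OF st] by blast
      ultimately show "k \<in> ?p ` {k. odd (colour x y k + d)}" using * by blast
    qed (use * in blast)
  qed
  also have "\<dots> \<longleftrightarrow> (\<forall>k. even (colour x y k + colour x y (?p k) + e))"
    by (intro all_cong1) auto
  finally show ?thesis .
qed


text \<open>Modulo 2, \<open>u\<close> read along \<open>s * i + a\<close> is \<open>v\<close> if
  \<open>c\<close> is even and the complement of \<open>v\<close> if \<open>c\<close> is odd. With
  \<open>c\<close> an integer, the effects of successive maps are added.\<close>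

definition agree :: "int \<Rightarrow> (int \<Rightarrow> int) \<Rightarrow> (int \<Rightarrow> int) \<Rightarrow> int \<Rightarrow> int \<Rightarrow> bool" where
  "agree s u v a c \<longleftrightarrow> (\<forall>i. even (u (s * i + a) + v i + c))"

text \<open>The parity contributed by naming a reflected edge by its other endpoint.\<close>

definition turn :: "int \<Rightarrow> int" where
  "turn s = (if s = 1 then 0 else 1)"

text \<open>The isometry preserves colours if \<open>e\<close> is even and reverses them if \<open>e\<close> is odd.\<close>

definition sym_cond ::
  "(int \<Rightarrow> int) \<Rightarrow> (int \<Rightarrow> int) \<Rightarrow> int \<Rightarrow> bool \<Rightarrow> int \<Rightarrow> int \<Rightarrow> int \<Rightarrow> int \<Rightarrow> bool" where
  "sym_cond x y e sw s t a b \<longleftrightarrow> s \<in> unit_signs \<and> t \<in> unit_signs \<and>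
    agree s x (if sw then y else x) a (b + e + turn t) \<and>
    agree t y (if sw then x else y) b (a + e + turn s)"

text \<open>The coordinate along a gridline enters the two colours up to sign only and cancels
  modulo 2. Of that direction there remain the offset and the turn, which is why the condition
  comparing gridlines carries the displacement along their images.\<close>

lemma sym_cond_colour:
  assumes "s \<in> unit_signs" "t \<in> unit_signs"
  shows "(\<forall>k. even (colour x y k + colour x y (edge_perm sw s t a b k) + e)) \<longleftrightarrow>
    sym_cond x y e sw s t a b"
proof -
  have st: "s = 1 \<or> s = - 1" "t = 1 \<or> t = - 1"
    using assms by (auto simp: unit_signs_def)
  have all: "(\<forall>k. P k) \<longleftrightarrow> (\<forall>i j. P (True, i, j)) \<and> (\<forall>i j. P (False, i, j))"
    for P :: "bool \<times> int \<times> int \<Rightarrow> bool"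
    by (metis (full_types) prod_cases3)
  have v: "even (colour x y (True, i, j) + colour x y (edge_perm sw s t a b (True, i, j)) + e) \<longleftrightarrow>
      (if sw then even (y (t * i + b) + x i + (a + e + turn s))
       else even (x (s * i + a) + x i + (b + e + turn t)))" for i j
    using st by (elim disjE; cases sw; auto simp: colour_def edge_perm_def turn_def)
  have h: "even (colour x y (False, i, j) + colour x y (edge_perm sw s t a b (False, i, j)) + e) \<longleftrightarrow>
      (if sw then even (x (s * j + a) + y j + (b + e + turn t))
       else even (y (t * j + b) + y j + (a + e + turn s)))" for i j
    using st by (elim disjE; cases sw; auto simp: colour_def edge_perm_def turn_def)
  show ?thesis
    unfolding all[of "\<lambda>k. even (colour x y k + colour x y (edge_perm sw s t a b k) + e)"] v h
      sym_cond_def agree_def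
    using assms by (cases sw) (simp_all only: if_True if_False simp_thms conj_commute)
qed

section \<open>Isometries that permute the edges of the grid\<close>

lemma isometry_affE:
  assumes "isometry f"
  obtains p q r s a b where "f = aff p q r s a b" "p * q + r * s = 0"
proof -
  define L where "L = (\<lambda>z. f z - f 0)"
  have "orthogonal_transformation L"
    using assms unfolding L_def orthogonal_transformation_isometry isometry_def dist_norm by simp
  then have lin: "linear L" and inner: "L u \<bullet> L v = u \<bullet> v" for u v
    unfolding orthogonal_transformation_def by blast+
  obtain p r where e1: "L (1, 0) = (p, r)" by fastforce
  obtain q s where e2: "L (0, 1) = (q, s)" by fastforce
  obtain a b where f0: "f 0 = (a, b)" by fastforce
  have "f (x, y) = aff p q r s a b (x, y)" for x y
  proof -
    have "L (x, y) = L (x *\<^sub>R (1, 0) + y *\<^sub>R (0, 1))" by simp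
    also have "\<dots> = x *\<^sub>R L (1, 0) + y *\<^sub>R L (0, 1)"
      using lin by (simp only: linear_add linear_scale)
    finally have "L (x, y) = (x * p + y * q, x * r + y * s)" by (simp add: e1 e2)
    then have "f (x, y) - f 0 = (x * p + y * q, x * r + y * s)" by (simp add: L_def)
    then have "f (x, y) = (x * p + y * q, x * r + y * s) + f 0" by (metis diff_add_cancel)
    then show ?thesis by (simp add: f0 algebra_simps)
  qed
  then have "f = aff p q r s a b" by auto
  moreover have "p * q + r * s = 0" using inner[of "(1, 0)" "(0, 1)"] by (simp add: e1 e2)
  ultimately show ?thesis using that by blast
qed

lemma isometry_grid_map:
  assumes "s \<in> unit_signs" "t \<in> unit_signs"
  shows "isometry (grid_map sw s t a b)"
  using assms
  by (auto simp: isometry_def grid_map_def unit_signs_def dist_Pair_Pair dist_real_def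
      add.commute power2_commute)

text \<open>Two edges at the origin suffice: their images show that the columns of the linear part
  are unit vectors along the axes and that the origin goes to a lattice point. Orthogonality keeps
  the columns off a common axis.\<close>

lemma grid_mapI:
  assumes f: "isometry f" and edges: "\<And>k. \<exists>k'. f ` edge k = edge k'"
  obtains sw s t a b where "s \<in> unit_signs" "t \<in> unit_signs" "f = grid_map sw s t a b"
proof -
  from isometry_affE[OF f] obtain p q r s c d
    where f: "f = aff p q r s c d" and orth: "p * q + r * s = 0" by blast
  obtain v i j where v: "f ` edge (True, 0, 0) = edge (v, i, j)" using edges[of "(True, 0, 0)"] by auto
  obtain h k l where h: "f ` edge (False, 0, 0) = edge (h, k, l)" using edges[of "(False, 0, 0)"] by auto
  have "{(c, d), (q + c, s + d)}
      = (if v then {vertex i j, vertex i (j + 1)} else {vertex i j, vertex (i + 1) j})"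
    using v by (simp add: f edge_def vertical_edge_def horizontal_edge_def vertex_def aff_image_segment
        closed_segment_eq split: if_splits)
  then have 1: "(q, s) \<in> {(0, 1), (0, - 1), (1, 0), (- 1, 0)}"
    and "(c, d) \<in> {vertex i j, vertex i (j + 1), vertex (i + 1) j}"
    by (auto simp: doubleton_eq_iff vertex_def split: if_splits)
  then have "c \<in> \<int> \<and> d \<in> \<int>" by (auto simp: vertex_def)
  then obtain a b :: int where ab: "c = of_int a" "d = of_int b" by (auto elim!: Ints_cases)
  have "{(c, d), (p + c, r + d)}
      = (if h then {vertex k l, vertex k (l + 1)} else {vertex k l, vertex (k + 1) l})"
    using h by (simp add: f edge_def vertical_edge_def horizontal_edge_def vertex_def aff_image_segment
        closed_segment_eq split: if_splits)
  then have 2: "(p, r) \<in> {(0, 1), (0, - 1), (1, 0), (- 1, 0)}"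
    by (auto simp: doubleton_eq_iff vertex_def split: if_splits)
  have "(\<exists>\<sigma>\<in>unit_signs. \<exists>\<tau>\<in>unit_signs. p = of_int \<sigma> \<and> s = of_int \<tau> \<and> q = 0 \<and> r = 0) \<or>
    (\<exists>\<sigma>\<in>unit_signs. \<exists>\<tau>\<in>unit_signs. q = of_int \<sigma> \<and> r = of_int \<tau> \<and> p = 0 \<and> s = 0)"
    using 1 2 orth by (auto simp: unit_signs_def)
  then show ?thesis
  proof (elim disjE bexE conjE)
    fix \<sigma> \<tau> assume "\<sigma> \<in> unit_signs" "\<tau> \<in> unit_signs" "p = of_int \<sigma>" "s = of_int \<tau>" "q = 0" "r = 0"
    then show ?thesis
      by - (rule that[of \<sigma> \<tau> False a b], simp_all add: f ab grid_map_def)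
  next
    fix \<sigma> \<tau> assume "\<sigma> \<in> unit_signs" "\<tau> \<in> unit_signs" "q = of_int \<sigma>" "r = of_int \<tau>" "p = 0" "s = 0"
    then show ?thesis
      by - (rule that[of \<sigma> \<tau> True a b], simp_all add: f ab grid_map_def)
  qed
qed

lemma stitch_maps_eq:
  "{f. isometry f \<and> (\<lambda>u. f ` u) ` edge ` {k. odd (colour x y k)} = edge ` {k. odd (colour x y k + e)}
        \<and> (\<lambda>u. f ` u) ` edge ` {k. even (colour x y k)} = edge ` {k. even (colour x y k + e)}}
    = {f. \<exists>sw s t a b. f = grid_map sw s t a b \<and> sym_cond x y e sw s t a b}" (is "?l = ?r")
proof (intro equalityI subsetI)
  fix f assume "f \<in> ?l"
  then have iso: "isometry f"
    and front: "(\<lambda>u. f ` u) ` edge ` {k. odd (colour x y k)} = edge ` {k. odd (colour x y k + e)}"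
    and rear: "(\<lambda>u. f ` u) ` edge ` {k. even (colour x y k)} = edge ` {k. even (colour x y k + e)}"
    by (simp_all only: mem_Collect_eq)
  have "\<exists>k'. f ` edge k = edge k'" for k
  proof (cases "odd (colour x y k)")
    case True
    then have "f ` edge k \<in> (\<lambda>u. f ` u) ` edge ` {k. odd (colour x y k)}" by simp
    then show ?thesis unfolding front by blast
  next
    case False
    then have "f ` edge k \<in> (\<lambda>u. f ` u) ` edge ` {k. even (colour x y k)}" by simp
    then show ?thesis unfolding rear by blast
  qed
  then obtain sw s t a b where st: "s \<in> unit_signs" "t \<in> unit_signs" and f: "f = grid_map sw s t a b"
    using grid_mapI[OF iso] by metis
  have "\<forall>k. even (colour x y k + colour x y (edge_perm sw s t a b k) + e)"
    using grid_map_stitches[OF st, of sw a b x y 0 e] front by (simp only: f add_0_right simp_thms)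
  then show "f \<in> ?r"
    unfolding sym_cond_colour[OF st] using f by blast
next
  fix f assume "f \<in> ?r"
  then obtain sw s t a b where f: "f = grid_map sw s t a b" and c: "sym_cond x y e sw s t a b"
    by blast
  then have st: "s \<in> unit_signs" "t \<in> unit_signs" by (auto simp: sym_cond_def)
  have c': "\<forall>k. even (colour x y k + colour x y (edge_perm sw s t a b k) + e)"
    unfolding sym_cond_colour[OF st] by (rule c)
  \<comment> \<open>Even colours are odd after adding 1, so the instance \<open>d = 1\<close> of
    \<open>grid_map_stitches\<close> covers the back stitches.\<close>
  have "even (colour x y k + e)  \<longleftrightarrow> odd (colour x y k + 1 + e)" "even (colour x y k) \<longleftrightarrow> odd (colour x y k + 1)" for k
    by simp_all
  with grid_map_stitches[OF st, of sw a b x y 0 e] grid_map_stitches[OF st, of sw a b x y 1 e] c'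
  show "f \<in> ?l"
    by (simp only: isometry_grid_map[OF st] f mem_Collect_eq add_0_right simp_thms)
qed

lemma symmetries_eq:
  "symmetries x y = {f. \<exists>sw s t a b. f = grid_map sw s t a b \<and> sym_cond x y 0 sw s t a b}"
  using stitch_maps_eq[of x y 0]
  by (simp add: symmetries_def front_stitches_colour back_stitches_colour)

lemma flip_symmetries_eq:
  "flip_symmetries x y = {f. \<exists>sw s t a b. f = grid_map sw s t a b \<and> sym_cond x y 1 sw s t a b}"
  using stitch_maps_eq[of x y 1]
  by (simp add: flip_symmetries_def front_stitches_colour back_stitches_colour)

section \<open>Standard groups in integer coordinates\<close>

text \<open>The last two components are the translation part in half units of the cell.\<close>

primrec positions :: "wallpaper_type \<Rightarrow> (int \<times> int \<times> int \<times> int \<times> int \<times> int) list" where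
  "positions P1 = [(1, 0, 0, 1, 0, 0)]"
| "positions P2 = [(1, 0, 0, 1, 0, 0), (-1, 0, 0, -1, 0, 0)]"
| "positions PM = [(1, 0, 0, 1, 0, 0), (-1, 0, 0, 1, 0, 0)]"
| "positions PG = [(1, 0, 0, 1, 0, 0), (-1, 0, 0, 1, 0, 1)]"
| "positions CM =
    [(1, 0, 0, 1, 0, 0), (-1, 0, 0, 1, 0, 0), (1, 0, 0, 1, 1, 1), (-1, 0, 0, 1, 1, 1)]"
| "positions PMM =
    [(1, 0, 0, 1, 0, 0), (-1, 0, 0, -1, 0, 0), (-1, 0, 0, 1, 0, 0), (1, 0, 0, -1, 0, 0)]"
| "positions PMG =
    [(1, 0, 0, 1, 0, 0), (-1, 0, 0, -1, 0, 0), (-1, 0, 0, 1, 1, 0), (1, 0, 0, -1, 1, 0)]"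
| "positions PGG =
    [(1, 0, 0, 1, 0, 0), (-1, 0, 0, -1, 0, 0), (-1, 0, 0, 1, 1, 1), (1, 0, 0, -1, 1, 1)]"
| "positions CMM =
    [(1, 0, 0, 1, 0, 0), (-1, 0, 0, -1, 0, 0), (-1, 0, 0, 1, 0, 0), (1, 0, 0, -1, 0, 0),
     (1, 0, 0, 1, 1, 1), (-1, 0, 0, -1, 1, 1), (-1, 0, 0, 1, 1, 1), (1, 0, 0, -1, 1, 1)]"
| "positions P4 =
    [(1, 0, 0, 1, 0, 0), (-1, 0, 0, -1, 0, 0), (0, -1, 1, 0, 0, 0), (0, 1, -1, 0, 0, 0)]"
| "positions P4M =
    [(1, 0, 0, 1, 0, 0), (-1, 0, 0, -1, 0, 0), (0, -1, 1, 0, 0, 0), (0, 1, -1, 0, 0, 0),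
     (-1, 0, 0, 1, 0, 0), (1, 0, 0, -1, 0, 0), (0, 1, 1, 0, 0, 0), (0, -1, -1, 0, 0, 0)]"
| "positions P4G =
    [(1, 0, 0, 1, 0, 0), (-1, 0, 0, -1, 0, 0), (0, -1, 1, 0, 0, 0), (0, 1, -1, 0, 0, 0),
     (-1, 0, 0, 1, 1, 1), (1, 0, 0, -1, 1, 1), (0, 1, 1, 0, 1, 1), (0, -1, -1, 0, 1, 1)]"
| "positions P3 = [(1, 0, 0, 1, 0, 0), (0, -1, 1, -1, 0, 0), (-1, 1, -1, 0, 0, 0)]"
| "positions P3M1 =
    [(1, 0, 0, 1, 0, 0), (0, -1, 1, -1, 0, 0), (-1, 1, -1, 0, 0, 0),
     (0, -1, -1, 0, 0, 0), (-1, 1, 0, 1, 0, 0), (1, 0, 1, -1, 0, 0)]"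
| "positions P31M =
    [(1, 0, 0, 1, 0, 0), (0, -1, 1, -1, 0, 0), (-1, 1, -1, 0, 0, 0),
     (0, 1, 1, 0, 0, 0), (1, -1, 0, -1, 0, 0), (-1, 0, -1, 1, 0, 0)]"
| "positions P6 =
    [(1, 0, 0, 1, 0, 0), (0, -1, 1, -1, 0, 0), (-1, 1, -1, 0, 0, 0),
     (-1, 0, 0, -1, 0, 0), (0, 1, -1, 1, 0, 0), (1, -1, 1, 0, 0, 0)]"
| "positions P6M =
    [(1, 0, 0, 1, 0, 0), (0, -1, 1, -1, 0, 0), (-1, 1, -1, 0, 0, 0),
     (-1, 0, 0, -1, 0, 0), (0, 1, -1, 1, 0, 0), (1, -1, 1, 0, 0, 0),
     (0, -1, -1, 0, 0, 0), (-1, 1, 0, 1, 0, 0), (1, 0, 1, -1, 0, 0),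
     (0, 1, 1, 0, 0, 0), (1, -1, 0, -1, 0, 0), (-1, 0, -1, 1, 0, 0)]"

definition half_map :: "int \<times> int \<times> int \<times> int \<times> int \<times> int \<Rightarrow> plane \<Rightarrow> plane" where
  "half_map = (\<lambda>(p, q, r, s, t, u).
    aff (of_int p) (of_int q) (of_int r) (of_int s) (of_int t / 2) (of_int u / 2))"

lemma general_positions_half_map: "general_positions T = half_map ` set (positions T)"
  by (cases T) (simp_all add: half_map_def aff_def insert_commute)

lemma standard_group_iff:
  "g \<in> standard_group T \<longleftrightarrow>
    (\<exists>(p, q, r, s, t, u)\<in>set (positions T). \<exists>m n. g = half_map (p, q, r, s, t + 2 * m, u + 2 * n))"
proof -
  have "(\<lambda>z. half_map (p, q, r, s, t, u) z + (real_of_int m, real_of_int n))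
      = half_map (p, q, r, s, t + 2 * m, u + 2 * n)" for p q r s t u m n
    by (auto simp: half_map_def add_divide_distrib)
  note * = this
  show ?thesis
  proof
    assume "g \<in> standard_group T"
    then obtain k m n where "k \<in> set (positions T)" "g = (\<lambda>z. half_map k z + (real_of_int m, real_of_int n))"
      unfolding standard_group_def general_positions_half_map by blast
    moreover obtain p q r s t u where "k = (p, q, r, s, t, u)" by (rule prod_cases6)
    ultimately have "(p, q, r, s, t, u) \<in> set (positions T)"
      "g = half_map (p, q, r, s, t + 2 * m, u + 2 * n)"
      by (simp_all only: *)
    then show "\<exists>(p, q, r, s, t, u)\<in>set (positions T). \<exists>m n. g = half_map (p, q, r, s, t + 2 * m, u + 2 * n)"
      by blast
  next
    assume "\<exists>(p, q, r, s, t, u)\<in>set (positions T). \<exists>m n. g = half_map (p, q, r, s, t + 2 * m, u + 2 * n)"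
    then obtain p q r s t u m n where "(p, q, r, s, t, u) \<in> set (positions T)"
      "g = (\<lambda>z. half_map (p, q, r, s, t, u) z + (real_of_int m, real_of_int n))"
      unfolding * by auto
    then show "g \<in> standard_group T"
      unfolding standard_group_def general_positions_half_map by blast
  qed
qed

lemma affine_bijection_aff:
  assumes "p * s - q * r \<noteq> 0"
  shows "affine_bijection (aff p q r s a b)"
proof -
  let ?d = "p * s - q * r"
  have "linear (aff p q r s 0 0)"
    by (rule linearI) (auto simp: algebra_simps aff_def split: prod.splits)
  moreover have "aff p q r s 0 0 \<circ> aff (s / ?d) (- q / ?d) (- r / ?d) (p / ?d) 0 0 = aff 1 0 0 1 0 0"
    "aff (s / ?d) (- q / ?d) (- r / ?d) (p / ?d) 0 0 \<circ> aff p q r s 0 0 = aff 1 0 0 1 0 0"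
    using assms by (simp_all add: diff_divide_distrib[symmetric] mult.commute)
  moreover have "aff 1 0 0 1 0 0 = id" by (auto simp: fun_eq_iff)
  ultimately have "linear (aff p q r s 0 0)" "bij (aff p q r s 0 0)"
    using o_bij by metis+
  moreover have "aff p q r s a b = (\<lambda>z. aff p q r s 0 0 z + (a, b))" by auto
  ultimately show ?thesis unfolding affine_bijection_def by blast
qed

lemma affine_bijection_bij: "affine_bijection \<phi> \<Longrightarrow> bij \<phi>"
proof -
  assume "affine_bijection \<phi>"
  then obtain L b where L: "bij L" "\<phi> = (\<lambda>z. z + b) \<circ> L"
    unfolding affine_bijection_def comp_def by blast
  have "bij (\<lambda>z. z + b)" by (rule bij_plus_right)
  with L show "bij \<phi>" by (simp only: bij_comp)
qed

text \<open>Without \<open>inv\<close>, conjugacy is an equation between compositions of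
  \<open>aff\<close> maps and can be compared by coefficients.\<close>

lemma conjugate_eq_iff:
  assumes "bij \<phi>"
  shows "f = \<phi> \<circ> g \<circ> inv \<phi> \<longleftrightarrow> f \<circ> \<phi> = \<phi> \<circ> g"
  using assms
  by (metis bij_is_inj bij_is_surj comp_assoc comp_id inv_o_cancel surj_iff)

lemma has_typeI:
  assumes "affine_bijection \<phi>"
    and "\<And>f. f \<in> G \<Longrightarrow> \<exists>g\<in>standard_group T. f \<circ> \<phi> = \<phi> \<circ> g"
    and "\<And>g. g \<in> standard_group T \<Longrightarrow> \<exists>f\<in>G. f \<circ> \<phi> = \<phi> \<circ> g"
  shows "has_type G T"
proof -
  note conj = conjugate_eq_iff[OF affine_bijection_bij[OF assms(1)]]
  have "G = {\<phi> \<circ> g \<circ> inv \<phi> | g. g \<in> standard_group T}"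
    using assms(2,3) unfolding conj[symmetric] by blast
  then show ?thesis using assms(1) unfolding has_type_def by blast
qed

section \<open>Composition rules for the parity conditions\<close>

lemma agree_comp:
  assumes "agree s u v a c" "agree s' v w a' c'"
  shows "agree (s * s') u w (s * a' + a) (c + c')"
  unfolding agree_def
proof
  fix i
  have "even (u (s * (s' * i + a') + a) + v (s' * i + a') + c)" "even (v (s' * i + a') + w i + c')"
    using assms by (simp_all only: agree_def)
  \<comment> \<open>The intermediate word \<open>v\<close> occurs twice in the sum and vanishes
    modulo 2.\<close>
  then have "even ((u (s * (s' * i + a') + a) + v (s' * i + a') + c) + (v (s' * i + a') + w i + c'))"
    by (rule dvd_add)
  moreover have "s * (s' * i + a') + a = s * s' * i + (s * a' + a)" by (simp add: algebra_simps)
  ultimately have "even ((u (s * s' * i + (s * a' + a)) + v (s' * i + a') + c) + (v (s' * i + a') + w i + c'))"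
    by simp
  then show "even (u (s * s' * i + (s * a' + a)) + w i + (c + c'))" by (simp, argo)
qed

lemma agree_trans:
  "agree 1 u u a c \<Longrightarrow> agree s u v a' c' \<Longrightarrow> agree s u v (a + a') (c + c')"
  using agree_comp[of 1 u u a c s v a' c'] by (simp add: add.commute)

lemma agree_neg: "agree 1 u u a c \<Longrightarrow> agree 1 u u (- a) (- c)"
  unfolding agree_def
proof
  fix i assume "\<forall>i. even (u (1 * i + a) + u i + c)"
  then have "even (u (1 * (i - a) + a) + u (i - a) + c)" by blast
  then show "even (u (1 * i + - a) + u i + - c)" by auto
qed

lemma agree_mult: "agree 1 u u a c \<Longrightarrow> agree 1 u u (k * a) (k * c)"
proof (induction k rule: int_induct[where k = 0])
  case base
  show ?case by (simp add: agree_def)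
next
  case (step1 k)
  then show ?case using agree_trans[of u a c 1 u "k * a" "k * c"] by (simp add: algebra_simps)
next
  case (step2 k)
  then show ?case using agree_trans[OF agree_neg, of u a c 1 u "k * a" "k * c"] by (simp add: algebra_simps)
qed

lemma agree_parity: "even (c - c') \<Longrightarrow> agree s u v a c \<longleftrightarrow> agree s u v a c'"
  by (auto simp: agree_def)

lemma sym_cond_parity: "even (e - e') \<Longrightarrow> sym_cond x y e sw s t a b \<longleftrightarrow> sym_cond x y e' sw s t a b"
  unfolding sym_cond_def
  by (auto simp: agree_parity[of "b + e + turn t" "b + e' + turn t"] agree_parity[of "a + e + turn s" "a + e' + turn s"])

text \<open>Composition with the \<open>k\<close>-th power of a translation, the colour effects
  being added. It reaches a whole coset of the lattice from one representative and the basis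
  translations.\<close>

lemma sym_cond_translate:
  assumes "sym_cond x y e False 1 1 a b" "sym_cond x y e' sw s t a' b'"
  shows "sym_cond x y (k * e + e') sw s t (k * a + a') (k * b + b')"
  using assms agree_trans[OF agree_mult[of x a "b + e" k], of s _ a' "b' + e' + turn t"]
    agree_trans[OF agree_mult[of y b "a + e" k], of t _ b' "a' + e' + turn s"]
  by (auto simp: sym_cond_def turn_def algebra_simps)

section \<open>Certificates for the type of a stitch group\<close>

definition stitch_group :: "int list \<Rightarrow> (int \<Rightarrow> int) \<Rightarrow> (int \<Rightarrow> int) \<Rightarrow> (plane \<Rightarrow> plane) set" where
  "stitch_group es x y = {f. \<exists>sw s t a b. f = grid_map sw s t a b \<and>
    (\<exists>e\<in>set es. sym_cond x y e sw s t a b)}"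

lemma stitch_group_simps:
  "stitch_group [0] x y = symmetries x y"
  "stitch_group [1] x y = flip_symmetries x y"
  "stitch_group [0, 1] x y = symmetries x y \<union> flip_symmetries x y"
  unfolding stitch_group_def symmetries_eq flip_symmetries_eq
  by (simp_all only: list.set bex_simps Un_def mem_Collect_eq conj_disj_distribL ex_disj_distrib
      simp_thms)

section \<open>Deciding the parity conditions for words given by lists\<close>

definition word :: "bool list \<Rightarrow> int \<Rightarrow> int" where
  "word w i = of_bool (w ! nat (i mod int (length w)))"

lemma periodic_word: "w \<noteq> [] \<Longrightarrow> periodic_binary_word (word w)"
  unfolding periodic_binary_word_def word_def
  by (rule conjI, simp, rule exI[of _ "int (length w)"], simp)

text \<open>All solutions of \<^const>\<open>agree\<close> for two words of the same length, up to periodicity.\<close>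

definition matches :: "int \<Rightarrow> bool list \<Rightarrow> bool list \<Rightarrow> (int \<times> bool) list" where
  "matches s w w' = [(int a, c). a \<leftarrow> [0..<length w], c \<leftarrow> [False, True],
    (if s = 1 then rotate a w else rotate (length w - Suc a) (rev w)) = (if c then map Not w' else w')]"

lemma matches_iff:
  "(int k, c) \<in> set (matches s w w') \<longleftrightarrow> k < length w \<and>
    (if s = 1 then rotate k w else rotate (length w - Suc k) (rev w)) = (if c then map Not w' else w')"
  by (cases c) (auto simp: matches_def)

text \<open>For \<open>s = 1\<close> the transported word is a rotation of \<open>w\<close>. For
  \<open>s = - 1\<close> its letter at \<open>i\<close> is that of \<open>w\<close> at
  \<open>a - i\<close>: reversal moves the letter at \<open>k = a mod n\<close> to position
  \<open>n - Suc k\<close>, and the rotation brings it to the front.\<close>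

lemma agree_word:
  assumes "length w = n" "length w' = n" "n > 0" "s \<in> unit_signs"
  shows "agree s (word w) (word w') a c \<longleftrightarrow> (a mod int n, odd c) \<in> set (matches s w w')"
proof -
  define k where "k = nat (a mod int n)"
  have k: "int k = a mod int n" "k < n" using assms by (auto simp: k_def nat_less_iff)
  define r where "r = (if s = 1 then rotate k w else rotate (n - Suc k) (rev w))"
  have r: "word w (s * int i + a) = of_bool (r ! i)" if "i < n" for i
  proof (cases "s = 1")
    case True
    have "(int i + a) mod int n = int ((k + i) mod n)"
      unfolding zmod_int of_nat_add k(1) mod_add_left_eq by (simp only: add.commute)
    moreover have "r ! i = w ! ((k + i) mod n)"
      using nth_rotate[of i w k] True assms that by (simp only: r_def if_True simp_thms)
    ultimately show ?thesis using True assms(1) by (simp only: word_def nat_int mult_1)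
  next
    case False
    then have s: "s = - 1" using assms by (simp add: unit_signs_def)
    \<comment> \<open>The natural number \<open>n + k - i\<close> stands for \<open>k - i\<close>
      modulo \<open>n\<close>. The rotated index wraps around exactly when \<open>i > k\<close>,
      hence the two cases.\<close>
    have "(n - Suc k + i) mod n = n - Suc ((n + k - i) mod n)"
    proof (cases "i \<le> k")
      case True
      then have "n + k - i = (k - i) + n" by linarith
      then have "(n + k - i) mod n = k - i" using k by (simp only: mod_add_self2) (rule mod_less, linarith)
      moreover have "(n - Suc k + i) mod n = n - Suc k + i" by (rule mod_less) (use True k in linarith)
      ultimately show ?thesis using True k by linarith
    next
      case False
      then have "(n + k - i) mod n = n + k - i" using that by (intro mod_less) linarith
      moreover have "n - Suc k + i = (i - Suc k) + n" using False k by linarith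
      moreover have "(i - Suc k) mod n = i - Suc k" using that by (intro mod_less) linarith
      ultimately have "(n - Suc k + i) mod n = i - Suc k" by (simp only: mod_add_self2)
      with \<open>(n + k - i) mod n = n + k - i\<close> show ?thesis using False k that by linarith
    qed
    moreover have "n - Suc (n - Suc ((n + k - i) mod n)) = (n + k - i) mod n"
      using mod_less_divisor[OF assms(3), of "n + k - i"] by linarith
    ultimately have "r ! i = w ! ((n + k - i) mod n)"
      using s assms that by (simp add: r_def nth_rotate rev_nth del: mod_less)
    moreover have "(a - int i) mod int n = int ((n + k - i) mod n)"
    proof -
      have "int (n + k - i) = a mod int n - int i + int n" using that k by simp
      then show ?thesis unfolding zmod_int by (simp add: mod_diff_left_eq)
    qed
    ultimately show ?thesis using s assms by (simp add: word_def)
  qed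
  have per: "word w (s * i + a) = word w (s * (i mod int n) + a)" for i
  proof -
    have "(s * (i mod int n) + a) mod int n = (s * i + a) mod int n"
      by (metis mod_add_left_eq mod_mult_right_eq)
    then show ?thesis using assms by (simp only: word_def)
  qed
  have per': "word w' i = word w' (i mod int n)" for i
    using assms by (simp add: word_def)
  have cell: "even (word w (s * int i + a) + word w' (int i) + c) \<longleftrightarrow> r ! i = (w' ! i \<noteq> odd c)"
    if "i < n" for i
  proof -
    have "word w' (int i) = of_bool (w' ! i)" using that assms by (simp add: word_def)
    then show ?thesis unfolding r[OF that] by (cases "r ! i"; cases "w' ! i") simp_all
  qed
  have "agree s (word w) (word w') a c \<longleftrightarrow>
      (\<forall>i<n. even (word w (s * int i + a) + word w' (int i) + c))"
  proof
    assume *: "\<forall>i<n. even (word w (s * int i + a) + word w' (int i) + c)"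
    show "agree s (word w) (word w') a c"
      unfolding agree_def
    proof
      fix i
      have "int (nat (i mod int n)) = i mod int n" "nat (i mod int n) < n"
        using assms by (simp_all add: nat_less_iff)
      then have "even (word w (s * (i mod int n) + a) + word w' (i mod int n) + c)"
        using * by metis
      then show "even (word w (s * i + a) + word w' i + c)"
        by (simp only: per[of i, symmetric] per'[of i, symmetric])
    qed
  qed (simp add: agree_def)
  also have "\<dots> \<longleftrightarrow> (\<forall>i<n. r ! i = (w' ! i \<noteq> odd c))"
    using cell by blast
  also have "\<dots> \<longleftrightarrow> r = (if odd c then map Not w' else w')"
    using assms by (auto simp: list_eq_iff_nth_eq r_def)
  also have "\<dots> \<longleftrightarrow> (int k, odd c) \<in> set (matches s w w')"
    using k(2) assms(1) by (simp add: matches_iff r_def)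
  finally show ?thesis by (simp add: k)
qed

lemma set_match_pairs:
  "(a, b) \<in> set [(a, b). (a, c) \<leftarrow> xs, (b, d) \<leftarrow> ys, e \<leftarrow> es, c = f b e \<and> d = g a e] \<longleftrightarrow>
    (\<exists>e\<in>set es. (a, f b e) \<in> set xs \<and> (b, g a e) \<in> set ys)"
  by force

text \<open>Executable form of \<open>sym_cond\<close>: the translation parts, reduced modulo the
  common word length, that a point operation admits with some effect in \<open>es\<close>.\<close>

definition elements :: "int list \<Rightarrow> bool list \<Rightarrow> bool list \<Rightarrow> bool \<Rightarrow> int \<Rightarrow> int \<Rightarrow> (int \<times> int) list" where
  "elements es w1 w2 sw s t = [(a, b).
    (a, c) \<leftarrow> matches s w1 (if sw then w2 else w1),
    (b, d) \<leftarrow> matches t w2 (if sw then w1 else w2),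
    e \<leftarrow> es, c = odd (b + e + turn t) \<and> d = odd (a + e + turn s)]"

text \<open>The parities of \<open>a\<close> and \<open>b\<close> enter the conditions besides their
  residues; an even word length makes them functions of the residues.\<close>

lemma elements_iff:
  assumes len: "length w1 = n" "length w2 = n" "n > 0" "even n" and st: "s \<in> unit_signs" "t \<in> unit_signs"
  shows "(\<exists>e\<in>set es. sym_cond (word w1) (word w2) e sw s t a b) \<longleftrightarrow>
    (a mod int n, b mod int n) \<in> set (elements es w1 w2 sw s t)"
proof -
  have "odd (a mod int n) \<longleftrightarrow> odd a" "odd (b mod int n) \<longleftrightarrow> odd b"
    using len(4) by (simp_all add: dvd_mod_iff)
  then have par: "odd (a mod int n + e + turn s) \<longleftrightarrow> odd (a + e + turn s)"
    "odd (b mod int n + e + turn t) \<longleftrightarrow> odd (b + e + turn t)" for e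
    by simp_all
  have "sym_cond (word w1) (word w2) e sw s t a b \<longleftrightarrow>
      (a mod int n, odd (b + e + turn t)) \<in> set (matches s w1 (if sw then w2 else w1)) \<and>
      (b mod int n, odd (a + e + turn s)) \<in> set (matches t w2 (if sw then w1 else w2))" for e
    using agree_word[OF len(1) _ len(3) st(1)] agree_word[OF len(2) _ len(3) st(2)] len st
    by (cases sw) (simp_all add: sym_cond_def)
  then have "(\<exists>e\<in>set es. sym_cond (word w1) (word w2) e sw s t a b) \<longleftrightarrow>
    (\<exists>e\<in>set es.
      (a mod int n, odd (b mod int n + e + turn t)) \<in> set (matches s w1 (if sw then w2 else w1)) \<and>
      (b mod int n, odd (a mod int n + e + turn s)) \<in> set (matches t w2 (if sw then w1 else w2)))"
    by (simp only: par)
  also have "\<dots> \<longleftrightarrow> (a mod int n, b mod int n) \<in> set (elements es w1 w2 sw s t)"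
    unfolding elements_def by (rule set_match_pairs[symmetric])
  finally show ?thesis .
qed

section \<open>Change to cell coordinates over the integers\<close>

definition point_ops :: "(bool \<times> int \<times> int) list" where
  "point_ops = [(sw, s, t). sw \<leftarrow> [False, True], s \<leftarrow> [1, - 1], t \<leftarrow> [1, - 1]]"

lemma set_point_ops: "set point_ops = {(sw, s, t). s \<in> unit_signs \<and> t \<in> unit_signs}"
  by (auto simp: point_ops_def unit_signs_def)

text \<open>
  The passage from cell coordinates to the plane is \<open>z \<mapsto> M z + c / 2\<close> with integral \<open>M\<close> and \<open>c\<close>. A
  grid map is conjugate to a general position if the linear parts match and a linear system for the
  integer translation is solvable, which is decided with the adjugate of \<open>M\<close>.
\<close>

fun frame_matches ::
  "int \<times> int \<times> int \<times> int \<Rightarrow> bool \<times> int \<times> int \<Rightarrow> int \<times> int \<times> int \<times> int \<times> int \<times> int \<Rightarrow> bool" where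
  "frame_matches (m1, m2, m3, m4) (sw, s, t) (p, q, r, v, _, _) \<longleftrightarrow>
    (if sw then m1 * p + m2 * r = s * m3 \<and> m1 * q + m2 * v = s * m4 \<and>
        m3 * p + m4 * r = t * m1 \<and> m3 * q + m4 * v = t * m2
     else m1 * p + m2 * r = s * m1 \<and> m1 * q + m2 * v = s * m2 \<and>
        m3 * p + m4 * r = t * m3 \<and> m3 * q + m4 * v = t * m4)"

text \<open>In half units this is \<open>M h + c - R c\<close>, with \<open>R\<close> the point
  operation and \<open>h\<close> the translation part of the general position: the translation of
  the conjugated position, up to \<open>2 M (m, n)\<close>.\<close>

fun frame_offset ::
  "int \<times> int \<times> int \<times> int \<Rightarrow> int \<times> int \<Rightarrow> bool \<times> int \<times> int \<Rightarrow> int \<times> int \<times> int \<times> int \<times> int \<times> int \<Rightarrow> int \<times> int" where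
  "frame_offset (m1, m2, m3, m4) (c1, c2) (sw, s, t) (_, _, _, _, h1, h2) =
    (m1 * h1 + m2 * h2 + c1 - s * (if sw then c2 else c1),
     m3 * h1 + m4 * h2 + c2 - t * (if sw then c1 else c2))"

lemma half_eq_iff:
  "real_of_int s * real_of_int c / 2 + real_of_int a =
      real_of_int k * real_of_int (h + 2 * m) / 2 + real_of_int k' * real_of_int (h' + 2 * n) / 2
        + real_of_int c' / 2 \<longleftrightarrow>
    2 * a = k * h + k' * h' + c' - s * c + (2 * (k * m) + 2 * (k' * n))"
proof -
  have "2 * a = k * h + k' * h' + c' - s * c + (2 * (k * m) + 2 * (k' * n)) \<longleftrightarrow>
      real_of_int (2 * a) = real_of_int (k * h + k' * h' + c' - s * c + (2 * (k * m) + 2 * (k' * n)))"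
    by (simp only: of_int_eq_iff)
  also have "\<dots> \<longleftrightarrow> real_of_int s * real_of_int c / 2 + real_of_int a =
      real_of_int k * real_of_int (h + 2 * m) / 2 + real_of_int k' * real_of_int (h' + 2 * n) / 2
        + real_of_int c' / 2"
    unfolding of_int_add of_int_diff of_int_mult of_int_numeral add_divide_distrib distrib_left
    by (simp add: algebra_simps, linarith)
  finally show ?thesis by simp
qed

lemma frame_conj_iff:
  assumes "frame_matches (m1, m2, m3, m4) (sw, s, t) (p, q, r, v, h1, h2)"
    and "frame_offset (m1, m2, m3, m4) (c1, c2) (sw, s, t) (p, q, r, v, h1, h2) = (o1, o2)"
  shows "grid_map sw s t a b \<circ> aff (of_int m1) (of_int m2) (of_int m3) (of_int m4) (of_int c1 / 2) (of_int c2 / 2)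
      = aff (of_int m1) (of_int m2) (of_int m3) (of_int m4) (of_int c1 / 2) (of_int c2 / 2)
        \<circ> half_map (p, q, r, v, h1 + 2 * m, h2 + 2 * n) \<longleftrightarrow>
    2 * a = o1 + 2 * (m1 * m + m2 * n) \<and> 2 * b = o2 + 2 * (m3 * m + m4 * n)"
proof -
  have eqs: "real_of_int i * real_of_int j + real_of_int k * real_of_int l = real_of_int u * real_of_int w"
    if "i * j + k * l = u * w" for i j k l u w
    using that by (metis of_int_add of_int_mult)
  show ?thesis
    using assms eqs
    by (cases sw) (simp_all add: grid_map_def half_map_def half_eq_iff del: of_int_add of_int_mult)
qed

fun frame_solvable :: "int \<times> int \<times> int \<times> int \<Rightarrow> int \<times> int \<Rightarrow> bool" where
  "frame_solvable (m1, m2, m3, m4) (a, b) \<longleftrightarrow>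
    (let d = 2 * (m1 * m4 - m2 * m3) in
      (m4 * a - m2 * b) mod d = 0 \<and> (m1 * b - m3 * a) mod d = 0)"

lemma frame_solvableD:
  assumes "frame_solvable (m1, m2, m3, m4) (a, b)" "m1 * m4 - m2 * m3 \<noteq> 0"
  obtains m n where "a = 2 * (m1 * m + m2 * n)" "b = 2 * (m3 * m + m4 * n)"
proof -
  define d where "d = m1 * m4 - m2 * m3"
  from assms have "2 * d dvd m4 * a - m2 * b" "2 * d dvd m1 * b - m3 * a"
    by (auto simp: Let_def d_def)
  then obtain m n where mn: "m4 * a - m2 * b = 2 * d * m" "m1 * b - m3 * a = 2 * d * n"
    by (elim dvdE)
  have "d * a = m1 * (m4 * a - m2 * b) + m2 * (m1 * b - m3 * a)"
    "d * b = m3 * (m4 * a - m2 * b) + m4 * (m1 * b - m3 * a)"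
    by (simp_all add: d_def algebra_simps)
  then have "d * a = d * (2 * (m1 * m + m2 * n))" "d * b = d * (2 * (m3 * m + m4 * n))"
    unfolding mn by (simp_all add: algebra_simps)
  moreover have "d \<noteq> 0" using assms by (simp add: d_def)
  ultimately have "a = 2 * (m1 * m + m2 * n)" "b = 2 * (m3 * m + m4 * n)"
    by (simp_all only: mult_cancel_left simp_thms)
  then show ?thesis by (rule that)
qed

lemma frame_solvable_mod:
  assumes "(m4 * n) mod d = 0" "(m2 * n) mod d = 0" "(m1 * n) mod d = 0" "(m3 * n) mod d = 0"
    and "d = m1 * m4 - m2 * m3"
  shows "frame_solvable (m1, m2, m3, m4) (2 * (a mod n) - o1, 2 * (b mod n) - o2)
    \<longleftrightarrow> frame_solvable (m1, m2, m3, m4) (2 * a - o1, 2 * b - o2)"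
proof -
  have *: "(k * (2 * (a mod n) - o1) - l * (2 * (b mod n) - o2)) mod (2 * d) = 0 \<longleftrightarrow>
      (k * (2 * a - o1) - l * (2 * b - o2)) mod (2 * d) = 0"
    if "d dvd k * n" "d dvd l * n" for k l a b o1 o2
  proof -
    have "(k * (2 * a - o1) - l * (2 * b - o2)) - (k * (2 * (a mod n) - o1) - l * (2 * (b mod n) - o2))
        = 2 * (k * (a - a mod n) - l * (b - b mod n))"
      by (simp add: algebra_simps)
    also have "\<dots> = 2 * ((k * n) * (a div n) - (l * n) * (b div n))"
      by (simp add: minus_mod_eq_mult_div mult.assoc)
    also have "2 * d dvd \<dots>" 
      by (rule mult_dvd_mono[OF dvd_refl dvd_diff[OF dvd_mult2[OF that(1)] dvd_mult2[OF that(2)]]])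
    finally show ?thesis by (simp only: mod_eq_dvd_iff[symmetric])
  qed
  show ?thesis
    unfolding frame_solvable.simps Let_def assms(5)[symmetric]
    using *[of m4 m2 a o1 b o2] *[of m1 m3 b o2 a o1] assms(1-4) by (simp only: dvd_eq_mod_eq_0)
qed

text \<open>\<open>hits\<close> and \<open>represents\<close> are the two inclusions between the
  stitch group and the conjugated standard group, each for one element. In \<open>represents\<close>
  the integer translation is 0, so half of the offset must be integral and occur in the
  list.\<close>

definition hits ::
  "int \<times> int \<times> int \<times> int \<Rightarrow> int \<times> int \<Rightarrow> bool \<times> int \<times> int \<Rightarrow> int \<times> int \<Rightarrow> int \<times> int \<times> int \<times> int \<times> int \<times> int \<Rightarrow> bool" where
  "hits M c g ab k \<longleftrightarrow> frame_matches M g k \<and>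
    frame_solvable M (2 * fst ab - fst (frame_offset M c g k), 2 * snd ab - snd (frame_offset M c g k))"

definition represents ::
  "int \<times> int \<times> int \<times> int \<Rightarrow> int \<times> int \<Rightarrow> (bool \<Rightarrow> int \<Rightarrow> int \<Rightarrow> (int \<times> int) list) \<Rightarrow> int \<Rightarrow>
    int \<times> int \<times> int \<times> int \<times> int \<times> int \<Rightarrow> bool \<times> int \<times> int \<Rightarrow> bool" where
  "represents M c els n k g \<longleftrightarrow> frame_matches M g k \<and>
    even (fst (frame_offset M c g k)) \<and> even (snd (frame_offset M c g k)) \<and>
    (fst (frame_offset M c g k) div 2 mod n, snd (frame_offset M c g k) div 2 mod n)
      \<in> set (els (fst g) (fst (snd g)) (snd (snd g)))"

fun good_frame :: "int \<times> int \<times> int \<times> int \<Rightarrow> (int \<times> int) list \<Rightarrow> int \<Rightarrow> bool" where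
  "good_frame (m1, m2, m3, m4) ts n \<longleftrightarrow>
    m1 * m4 - m2 * m3 \<noteq> 0 \<and>
    m1 * n mod (m1 * m4 - m2 * m3) = 0 \<and> m2 * n mod (m1 * m4 - m2 * m3) = 0 \<and>
    m3 * n mod (m1 * m4 - m2 * m3) = 0 \<and> m4 * n mod (m1 * m4 - m2 * m3) = 0 \<and>
    (m1 mod n, m3 mod n) \<in> set ts \<and> (m2 mod n, m4 mod n) \<in> set ts"

text \<open>
  The divisibility conditions in \<^const>\<open>good_frame\<close> make solvability periodic in the translation, so
  that finitely many translations suffice for one inclusion. For the other one, the words need
  only be tested on the general positions and on the two basis translations.
\<close>

definition certifies ::
  "int \<times> int \<times> int \<times> int \<Rightarrow> int \<times> int \<Rightarrow> int list \<Rightarrow> wallpaper_type \<Rightarrow> bool list \<Rightarrow> bool list \<Rightarrow> bool" where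
  "certifies M c es T w1 w2 \<longleftrightarrow>
    (es = [0] \<or> es = [0, 1]) \<and> length w1 > 0 \<and> even (length w1) \<and> length w2 = length w1 \<and>
    good_frame M (elements es w1 w2 False 1 1) (int (length w1)) \<and>
    (\<forall>g\<in>set point_ops. \<forall>ab\<in>set (elements es w1 w2 (fst g) (fst (snd g)) (snd (snd g))).
      \<exists>k\<in>set (positions T). hits M c g ab k) \<and>
    (\<forall>k\<in>set (positions T). \<exists>g\<in>set point_ops.
      represents M c (elements es w1 w2) (int (length w1)) k g)"

lemma certifies_has_type:
  assumes cert: "certifies M c es T w1 w2"
  shows "has_type (stitch_group es (word w1) (word w2)) T"
proof -
  obtain m1 m2 m3 m4 where M: "M = (m1, m2, m3, m4)" by (rule prod_cases4)
  obtain c1 c2 where c: "c = (c1, c2)" by fastforce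
  define n where "n = length w1"
  define d where "d = m1 * m4 - m2 * m3"
  have es: "es = [0] \<or> es = [0, 1]" and len: "length w1 = n" "length w2 = n" "n > 0" "even n"
    and good: "good_frame M (elements es w1 w2 False 1 1) (int n)"
    and hit: "\<And>g ab. g \<in> set point_ops \<Longrightarrow> ab \<in> set (elements es w1 w2 (fst g) (fst (snd g)) (snd (snd g))) \<Longrightarrow>
      \<exists>k\<in>set (positions T). hits M c g ab k"
    and rep: "\<And>k. k \<in> set (positions T) \<Longrightarrow> \<exists>g\<in>set point_ops. represents M c (elements es w1 w2) (int n) k g"
    using cert unfolding certifies_def n_def by blast+
  have d: "d \<noteq> 0"
    and mods: "m1 * int n mod d = 0" "m2 * int n mod d = 0" "m3 * int n mod d = 0" "m4 * int n mod d = 0"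
    and basis: "(m1 mod int n, m3 mod int n) \<in> set (elements es w1 w2 False 1 1)"
      "(m2 mod int n, m4 mod int n) \<in> set (elements es w1 w2 False 1 1)"
    using good by (simp_all add: M d_def)
  note solvable_mod = frame_solvable_mod[OF mods(4,2,1,3) d_def]
  let ?\<phi> = "aff (of_int m1) (of_int m2) (of_int m3) (of_int m4) (of_int c1 / 2) (of_int c2 / 2)"
  let ?G = "stitch_group es (word w1) (word w2)"
  note els = elements_iff[OF len, of _ _ es]
  have "real_of_int m1 * real_of_int m4 - real_of_int m2 * real_of_int m3 = real_of_int d"
    by (simp add: d_def)
  then have "affine_bijection ?\<phi>"
    using d by (intro affine_bijection_aff) simp
  moreover have "\<exists>g\<in>standard_group T. f \<circ> ?\<phi> = ?\<phi> \<circ> g" if "f \<in> ?G" for f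
  proof -
    from that obtain sw s t a b e where f: "f = grid_map sw s t a b" and e: "e \<in> set es"
      and cond: "sym_cond (word w1) (word w2) e sw s t a b"
      unfolding stitch_group_def by blast
    have st: "s \<in> unit_signs" "t \<in> unit_signs" using cond by (simp_all add: sym_cond_def)
    have "(a mod int n, b mod int n) \<in> set (elements es w1 w2 sw s t)"
      using els[OF st] e cond by blast
    moreover have "(sw, s, t) \<in> set point_ops" using st by (simp add: set_point_ops)
    ultimately obtain k where k: "k \<in> set (positions T)"
      and h: "hits M c (sw, s, t) (a mod int n, b mod int n) k"
      using hit[of "(sw, s, t)" "(a mod int n, b mod int n)"] by auto
    obtain p q r v h1 h2 where k': "k = (p, q, r, v, h1, h2)" by (rule prod_cases6)
    obtain o1 o2 where o: "frame_offset (m1, m2, m3, m4) (c1, c2) (sw, s, t) (p, q, r, v, h1, h2) = (o1, o2)"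
      by (rule prod.exhaust)
    have match: "frame_matches (m1, m2, m3, m4) (sw, s, t) (p, q, r, v, h1, h2)"
      and "frame_solvable (m1, m2, m3, m4) (2 * (a mod int n) - o1, 2 * (b mod int n) - o2)"
      using h unfolding hits_def M c k' o fst_conv snd_conv by blast+
    then have "frame_solvable (m1, m2, m3, m4) (2 * a - o1, 2 * b - o2)"
      unfolding solvable_mod by blast
    then obtain m l where "2 * a - o1 = 2 * (m1 * m + m2 * l)" "2 * b - o2 = 2 * (m3 * m + m4 * l)"
      using d unfolding d_def by (rule frame_solvableD)
    then have "2 * a = o1 + 2 * (m1 * m + m2 * l)" "2 * b = o2 + 2 * (m3 * m + m4 * l)"
      by linarith+
    then have "f \<circ> ?\<phi> = ?\<phi> \<circ> half_map (p, q, r, v, h1 + 2 * m, h2 + 2 * l)"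
      unfolding f using frame_conj_iff[OF match o] by blast
    moreover have "half_map (p, q, r, v, h1 + 2 * m, h2 + 2 * l) \<in> standard_group T"
      unfolding standard_group_iff using k k' by blast
    ultimately show ?thesis by blast
  qed
  moreover have "\<exists>f\<in>?G. f \<circ> ?\<phi> = ?\<phi> \<circ> g" if "g \<in> standard_group T" for g
  proof -
    from that obtain p q r v h1 h2 m l where k: "(p, q, r, v, h1, h2) \<in> set (positions T)"
      and g: "g = half_map (p, q, r, v, h1 + 2 * m, h2 + 2 * l)"
      unfolding standard_group_iff by blast
    from rep[OF k] obtain sw s t where "(sw, s, t) \<in> set point_ops"
      and r: "represents M c (elements es w1 w2) (int n) (p, q, r, v, h1, h2) (sw, s, t)"
      by auto
    then have st: "s \<in> unit_signs" "t \<in> unit_signs" by (simp_all add: set_point_ops)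
    obtain o1 o2 where o: "frame_offset (m1, m2, m3, m4) (c1, c2) (sw, s, t) (p, q, r, v, h1, h2) = (o1, o2)"
      by (rule prod.exhaust)
    have match: "frame_matches (m1, m2, m3, m4) (sw, s, t) (p, q, r, v, h1, h2)"
      and ev: "even o1" "even o2"
      and mem: "(o1 div 2 mod int n, o2 div 2 mod int n) \<in> set (elements es w1 w2 sw s t)"
      using r unfolding represents_def M c o fst_conv snd_conv by blast+
    obtain e where e: "e \<in> set es" "sym_cond (word w1) (word w2) e sw s t (o1 div 2) (o2 div 2)"
      using els[OF st] mem by blast
    have one: "1 \<in> unit_signs" by (simp add: unit_signs_def)
    obtain e1 where e1: "e1 \<in> set es" "sym_cond (word w1) (word w2) e1 False 1 1 m1 m3"
      using els[OF one one] basis(1) by blast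
    obtain e2 where e2: "e2 \<in> set es" "sym_cond (word w1) (word w2) e2 False 1 1 m2 m4"
      using els[OF one one] basis(2) by blast
    define e' where "e' = m * e1 + (l * e2 + e)"
    define a where "a = m * m1 + (l * m2 + o1 div 2)"
    define b where "b = m * m3 + (l * m4 + o2 div 2)"
    have "sym_cond (word w1) (word w2) e' sw s t a b"
      unfolding e'_def a_def b_def by (intro sym_cond_translate e e1 e2)
    then have "sym_cond (word w1) (word w2) (e' mod 2) sw s t a b"
      using sym_cond_parity[of e' "e' mod 2"] by (simp add: minus_mod_eq_mult_div)
    moreover have "e' mod 2 \<in> set es"
      using es
    proof
      assume "es = [0]"
      then show ?thesis using e(1) e1(1) e2(1) by (simp add: e'_def)
    next
      assume "es = [0, 1]"
      moreover have "e' mod 2 = 0 \<or> e' mod 2 = 1" by presburger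
      ultimately show ?thesis by auto
    qed
    ultimately have "grid_map sw s t a b \<in> ?G" unfolding stitch_group_def by blast
    moreover have "2 * a = o1 + 2 * (m1 * m + m2 * l)" "2 * b = o2 + 2 * (m3 * m + m4 * l)"
      using ev by (simp_all add: a_def b_def algebra_simps)
    then have "grid_map sw s t a b \<circ> ?\<phi> = ?\<phi> \<circ> g"
      unfolding g using frame_conj_iff[OF match o] by blast
    ultimately show ?thesis by blast
  qed
  ultimately show ?thesis by (rule has_typeI)
qed

section \<open>Conjugation invariants\<close>

definition shift :: "plane \<Rightarrow> plane \<Rightarrow> plane" where
  "shift t = (\<lambda>p. p + t)"

definition translation :: "(plane \<Rightarrow> plane) \<Rightarrow> bool" where
  "translation f \<longleftrightarrow> (\<exists>t. f = shift t)"

definition half_turn :: "(plane \<Rightarrow> plane) \<Rightarrow> bool" where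
  "half_turn f \<longleftrightarrow> (\<exists>c. f = (\<lambda>p. c - p))"

text \<open>A description of reflections without a metric, hence stable under affine conjugation:
  the involutive isometries are the identity, the half turns and the reflections.\<close>

definition mirror :: "(plane \<Rightarrow> plane) \<Rightarrow> bool" where
  "mirror f \<longleftrightarrow> f \<circ> f = id \<and> \<not> translation f \<and> \<not> half_turn f"

definition conj_map :: "(plane \<Rightarrow> plane) \<Rightarrow> (plane \<Rightarrow> plane) \<Rightarrow> plane \<Rightarrow> plane" where
  "conj_map \<phi> g = \<phi> \<circ> g \<circ> inv \<phi>"

lemma shift_aff: "shift (a, b) = aff 1 0 0 1 a b"
  by (auto simp: shift_def fun_eq_iff)

lemma id_aff: "id = aff 1 0 0 1 0 0"
  by (auto simp: fun_eq_iff)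

lemma translation_aff [simp]: "translation (aff p q r s a b) \<longleftrightarrow> p = 1 \<and> q = 0 \<and> r = 0 \<and> s = 1"
  unfolding translation_def split_paired_Ex shift_aff by auto

lemma half_turn_aff [simp]: "half_turn (aff p q r s a b) \<longleftrightarrow> p = - 1 \<and> q = 0 \<and> r = 0 \<and> s = - 1"
proof -
  have "(\<lambda>p. (c, d) - p) = aff (- 1) 0 0 (- 1) c d" for c d :: real
    by (auto simp: fun_eq_iff)
  then show ?thesis unfolding half_turn_def split_paired_Ex by auto
qed

lemma has_type_conjE:
  assumes "has_type G T"
  obtains \<phi> where "affine_bijection \<phi>" "G = conj_map \<phi> ` standard_group T"
  using assms unfolding has_type_def conj_map_def by blast

lemma affine_bijection_inv:
  assumes "affine_bijection \<phi>"
  shows "affine_bijection (inv \<phi>)"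
proof -
  obtain L b where L: "linear L" "bij L" and \<phi>: "\<phi> = (\<lambda>p. L p + b)"
    using assms unfolding affine_bijection_def by blast
  have "linear (inv L)"
    using L by (metis bij_is_inj bij_is_surj inj_linear_imp_inv_linear)
  moreover have "bij (inv L)" using L by (simp add: bij_imp_bij_inv)
  moreover have "inv \<phi> = (\<lambda>p. inv L p + inv L (- b))"
  proof (rule inv_equality)
    fix p
    show "inv L (\<phi> p) + inv L (- b) = p"
      using \<open>linear (inv L)\<close> L(2) by (simp add: \<phi> linear_add[symmetric] bij_is_inj)
    show "\<phi> (inv L p + inv L (- b)) = p"
      using \<open>linear (inv L)\<close> L by (simp add: \<phi> linear_add[symmetric] bij_is_surj surj_f_inv_f)
  qed
  ultimately show ?thesis unfolding affine_bijection_def by blast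
qed

lemma conj_map_comp:
  assumes "bij \<phi>"
  shows "conj_map \<phi> (f \<circ> g) = conj_map \<phi> f \<circ> conj_map \<phi> g"
  using assms by (simp add: conj_map_def fun_eq_iff bij_is_inj)

lemma conj_map_inv:
  assumes "bij \<phi>"
  shows "conj_map (inv \<phi>) (conj_map \<phi> f) = f"
  using assms by (simp add: conj_map_def fun_eq_iff bij_is_inj inv_inv_eq)

lemma conj_map_shift:
  assumes "bij \<phi>" "linear L" "\<phi> = (\<lambda>p. L p + b)"
  shows "conj_map \<phi> (shift t) = shift (L t)"
proof
  fix p
  have "\<phi> (inv \<phi> p) = p" using assms(1) by (simp add: bij_is_surj surj_f_inv_f)
  then have "L (inv \<phi> p) + b = p" using assms(3) by metis
  moreover have "conj_map \<phi> (shift t) p = (L (inv \<phi> p) + b) + L t"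
    using assms by (simp add: conj_map_def shift_def linear_add)
  ultimately show "conj_map \<phi> (shift t) p = shift (L t) p" by (simp add: shift_def)
qed

lemma conj_map_translation_imp:
  assumes "affine_bijection \<phi>" "translation f"
  shows "translation (conj_map \<phi> f)"
  using assms(1) affine_bijection_bij[OF assms(1)] assms(2) conj_map_shift
  unfolding affine_bijection_def translation_def by metis

lemma conj_map_half_turn_imp:
  assumes "affine_bijection \<phi>" "half_turn f"
  shows "half_turn (conj_map \<phi> f)"
proof -
  obtain L b where L: "linear L" and \<phi>: "\<phi> = (\<lambda>p. L p + b)"
    using assms(1) unfolding affine_bijection_def by blast
  obtain c where c: "f = (\<lambda>p. c - p)" using assms(2) unfolding half_turn_def by blast
  have "conj_map \<phi> f p = (L c + b + b) - p" for p
  proof -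
    have "\<phi> (inv \<phi> p) = p"
      using affine_bijection_bij[OF assms(1)] by (simp add: bij_is_surj surj_f_inv_f)
    then have *: "L (inv \<phi> p) + b = p" using \<phi> by metis
    have "conj_map \<phi> f p = L c + b + b - (L (inv \<phi> p) + b)"
      using L by (simp add: conj_map_def c \<phi> linear_diff)
    then show ?thesis unfolding * .
  qed
  then show ?thesis unfolding half_turn_def by blast
qed

lemma conj_map_simps:
  assumes "affine_bijection \<phi>"
  shows "translation (conj_map \<phi> f) \<longleftrightarrow> translation f"
    and "half_turn (conj_map \<phi> f) \<longleftrightarrow> half_turn f"
    and "conj_map \<phi> f = conj_map \<phi> g \<longleftrightarrow> f = g"
    and "conj_map \<phi> id = id"
    and "conj_map \<phi> f \<circ> conj_map \<phi> g = conj_map \<phi> (f \<circ> g)"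
proof -
  note bij = affine_bijection_bij[OF assms] and inv = affine_bijection_inv[OF assms]
  show "translation (conj_map \<phi> f) \<longleftrightarrow> translation f"
    using conj_map_translation_imp[OF assms] conj_map_translation_imp[OF inv] conj_map_inv[OF bij] by metis
  show "half_turn (conj_map \<phi> f) \<longleftrightarrow> half_turn f"
    using conj_map_half_turn_imp[OF assms] conj_map_half_turn_imp[OF inv] conj_map_inv[OF bij] by metis
  show "conj_map \<phi> f = conj_map \<phi> g \<longleftrightarrow> f = g"
    using conj_map_inv[OF bij] by metis
  show "conj_map \<phi> id = id"
    using bij by (simp add: conj_map_def fun_eq_iff bij_is_surj surj_f_inv_f)
  show "conj_map \<phi> f \<circ> conj_map \<phi> g = conj_map \<phi> (f \<circ> g)"
    by (simp add: conj_map_comp[OF bij])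
qed

lemma conj_map_mirror:
  assumes "affine_bijection \<phi>"
  shows "mirror (conj_map \<phi> f) \<longleftrightarrow> mirror f"
proof -
  have "conj_map \<phi> f \<circ> conj_map \<phi> f = id \<longleftrightarrow> f \<circ> f = id"
    using conj_map_simps[OF assms] by metis
  then show ?thesis unfolding mirror_def by (simp only: conj_map_simps[OF assms])
qed

text \<open>A glide by half a side of the cell plus \<open>n\<close> sides squares to a translation
  with component \<open>1 + 2 * n\<close>. That this never vanishes tells the glides of the standard
  groups from mirrors.\<close>

lemma odd_real_nonzero: "1 + 2 * real_of_int n \<noteq> 0"
proof -
  have "1 + 2 * n \<noteq> 0" by presburger
  then have "real_of_int (1 + 2 * n) \<noteq> 0" by (simp only: of_int_eq_0_iff not_False_eq_True)
  then show ?thesis by simp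
qed

section \<open>Mirrors and rotations in the standard groups\<close>

lemma standard_no_mirror:
  assumes "T \<in> {P1, P2, PG, PGG, P4}" "g \<in> standard_group T"
  shows "\<not> mirror g"
  using assms odd_real_nonzero
  by (auto simp: standard_group_iff half_map_def mirror_def id_aff)

lemma no_mirror:
  assumes "has_type G T" "T \<in> {P1, P2, PG, PGG, P4}" "f \<in> G"
  shows "\<not> mirror f"
proof -
  obtain \<phi> where \<phi>: "affine_bijection \<phi>" and G: "G = conj_map \<phi> ` standard_group T"
    using assms(1) by (rule has_type_conjE)
  obtain g where "g \<in> standard_group T" "f = conj_map \<phi> g" using assms(3) G by blast
  then show ?thesis using standard_no_mirror[OF assms(2)] by (simp only: conj_map_mirror[OF \<phi>] not_False_eq_True)
qed

lemma standard_group_memI: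
  "k \<in> set (positions T) \<Longrightarrow> half_map k \<in> standard_group T"
  unfolding standard_group_iff
  by (cases k, rule bexI[of _ k], simp, rule exI[of _ 0], rule exI[of _ 0], simp_all)

lemma has_half_turn:
  assumes "has_type G T" "T \<in> {PMM, PMG, PGG, CMM, P4M, P4G, P4}"
  shows "\<exists>h\<in>G. half_turn h" "\<exists>f\<in>G. \<not> translation f \<and> \<not> half_turn f"
proof -
  obtain \<phi> where \<phi>: "affine_bijection \<phi>" and G: "G = conj_map \<phi> ` standard_group T"
    using assms(1) by (rule has_type_conjE)
  let ?h = "half_map (-1, 0, 0, -1, 0, 0)"
  have "?h \<in> standard_group T"
    using assms(2) by (intro standard_group_memI) auto
  moreover have "half_turn ?h" by (simp add: half_map_def)
  ultimately show "\<exists>h\<in>G. half_turn h" unfolding G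
    by (metis conj_map_simps(2)[OF \<phi>] imageI)
  have "\<exists>k\<in>set (positions T). \<not> translation (half_map k) \<and> \<not> half_turn (half_map k)"
    using assms(2) by (auto simp: half_map_def)
  then obtain k where "half_map k \<in> standard_group T" "\<not> translation (half_map k)" "\<not> half_turn (half_map k)"
    using standard_group_memI by blast
  then show "\<exists>f\<in>G. \<not> translation f \<and> \<not> half_turn f" unfolding G
    by (metis conj_map_simps(1,2)[OF \<phi>] imageI)
qed

lemma hexagonal_order_three:
  assumes "has_type G T" "T \<in> {P31M, P3M1, P6, P6M}"
  shows "\<exists>f\<in>G. f \<circ> f \<circ> f = id \<and> f \<noteq> id"
proof -
  obtain \<phi> where \<phi>: "affine_bijection \<phi>" and G: "G = conj_map \<phi> ` standard_group T"
    using assms(1) by (rule has_type_conjE)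
  let ?g = "half_map (0, -1, 1, -1, 0, 0)"
  have g: "?g \<in> standard_group T"
    using assms(2) by (intro standard_group_memI) auto
  have id3: "?g \<circ> ?g \<circ> ?g = id" and "?g \<noteq> id" by (simp_all add: half_map_def id_aff)
  have "conj_map \<phi> ?g \<circ> conj_map \<phi> ?g \<circ> conj_map \<phi> ?g = id"
    by (simp only: conj_map_simps(5,4)[OF \<phi>] id3)
  moreover have "conj_map \<phi> ?g \<noteq> id"
    using \<open>?g \<noteq> id\<close> conj_map_simps(3)[OF \<phi>, of ?g id] unfolding conj_map_simps(4)[OF \<phi>] by simp
  ultimately have "conj_map \<phi> ?g \<circ> conj_map \<phi> ?g \<circ> conj_map \<phi> ?g = id" "conj_map \<phi> ?g \<noteq> id"
    by blast+
  then show ?thesis using g G by blast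
qed

definition linear_part :: "(plane \<Rightarrow> plane) \<Rightarrow> real \<Rightarrow> real \<Rightarrow> real \<Rightarrow> real \<Rightarrow> bool" where
  "linear_part f p q r s \<longleftrightarrow> (\<exists>a b. f = aff p q r s a b)"

lemma linear_part_aff [simp]:
  "linear_part (aff p q r s a b) p' q' r' s' \<longleftrightarrow> p = p' \<and> q = q' \<and> r = r' \<and> s = s'"
  by (auto simp: linear_part_def)

text \<open>The positions reflecting along a side of the cell carry the shift
  \<open>(1/2, 1/2)\<close> and are glides, so only the diagonal directions remain.\<close>

lemma standard_mirror_P4G:
  assumes "g \<in> standard_group P4G" "mirror g"
  shows "linear_part g 0 1 1 0 \<or> linear_part g 0 (- 1) (- 1) 0"
proof -
  obtain p q r s t u m n where "(p, q, r, s, t, u) \<in> set (positions P4G)"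
    and g: "g = half_map (p, q, r, s, t + 2 * m, u + 2 * n)"
    using assms(1) unfolding standard_group_iff by blast
  then have "(p, q, r, s, t, u) \<in> set (positions P4G) \<and> g \<circ> g = id \<and> \<not> translation g \<and> \<not> half_turn g"
    using assms(2) by (simp only: mirror_def simp_thms)
  then show ?thesis
    unfolding positions.simps list.set insert_iff empty_iff prod.inject
    by (elim conjE disjE; simp add: g half_map_def id_aff odd_real_nonzero)
qed

lemma standard_mirror_CMM:
  assumes "g \<in> standard_group CMM" "mirror g"
  shows "linear_part g (- 1) 0 0 1 \<or> linear_part g 1 0 0 (- 1)"
proof -
  obtain p q r s t u m n where "(p, q, r, s, t, u) \<in> set (positions CMM)"
    and g: "g = half_map (p, q, r, s, t + 2 * m, u + 2 * n)"
    using assms(1) unfolding standard_group_iff by blast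
  then have "(p, q, r, s, t, u) \<in> set (positions CMM) \<and> g \<circ> g = id \<and> \<not> translation g \<and> \<not> half_turn g"
    using assms(2) by (simp only: mirror_def simp_thms)
  then show ?thesis
    unfolding positions.simps list.set insert_iff empty_iff prod.inject
    by (elim conjE disjE; simp add: g half_map_def id_aff odd_real_nonzero)
qed

text \<open>In both types the mirrors take only two directions, and the linear parts commute. An
  axis-parallel and a diagonal mirror of the grid would compose to a quarter turn, whose square is
  no translation.\<close>

lemma mirrors_commute:
  assumes "has_type G T" "T = P4G \<or> T = CMM" "m \<in> G" "mirror m" "d \<in> G" "mirror d"
  shows "translation ((m \<circ> d) \<circ> (m \<circ> d))"
proof -
  obtain \<phi> where \<phi>: "affine_bijection \<phi>" and G: "G = conj_map \<phi> ` standard_group T"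
    using assms(1) by (rule has_type_conjE)
  obtain g h where gh: "g \<in> standard_group T" "h \<in> standard_group T" "m = conj_map \<phi> g" "d = conj_map \<phi> h"
    using assms(3,5) G by blast
  then have mir: "mirror g" "mirror h" using assms(4,6) by (simp_all only: conj_map_mirror[OF \<phi>])
  have "translation ((g \<circ> h) \<circ> (g \<circ> h))"
    using assms(2)
  proof
    assume T: "T = P4G"
    show ?thesis
      using standard_mirror_P4G[OF gh(1)[unfolded T] mir(1)] standard_mirror_P4G[OF gh(2)[unfolded T] mir(2)]
      unfolding linear_part_def by (elim disjE exE) simp_all
  next
    assume T: "T = CMM"
    show ?thesis
      using standard_mirror_CMM[OF gh(1)[unfolded T] mir(1)] standard_mirror_CMM[OF gh(2)[unfolded T] mir(2)]
      unfolding linear_part_def by (elim disjE exE) simp_all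
  qed
  then show ?thesis unfolding gh(3,4) by (simp only: conj_map_simps[OF \<phi>])
qed

lemma has_quarter_turn:
  assumes "has_type G T" "T \<in> {P4, P4M, P4G}"
  shows "\<exists>r\<in>G. half_turn (r \<circ> r)"
proof -
  obtain \<phi> where \<phi>: "affine_bijection \<phi>" and G: "G = conj_map \<phi> ` standard_group T"
    using assms(1) by (rule has_type_conjE)
  let ?g = "half_map (0, -1, 1, 0, 0, 0)"
  have g: "?g \<in> standard_group T"
    using assms(2) by (intro standard_group_memI) auto
  have "half_turn (?g \<circ> ?g)" by (simp add: half_map_def)
  then have "half_turn (conj_map \<phi> ?g \<circ> conj_map \<phi> ?g)" by (simp only: conj_map_simps[OF \<phi>])
  then show ?thesis using g G by blast
qed

section \<open>Rectangular and centred lattices of translations\<close>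

text \<open>
  The translations in \<open>G\<close> form a lattice that is rectangular with respect to the linear part of \<open>f\<close>:
  it is spanned by \<open>u\<close>, fixed by that linear part, and \<open>v\<close>, negated by it.
\<close>

definition frame :: "(plane \<Rightarrow> plane) set \<Rightarrow> (plane \<Rightarrow> plane) \<Rightarrow> plane \<Rightarrow> plane \<Rightarrow> bool" where
  "frame G f u v \<longleftrightarrow> u \<noteq> 0 \<and> v \<noteq> 0 \<and> (\<forall>p. f (p + u) = f p + u) \<and> (\<forall>p. f (p + v) = f p - v) \<and>
    (\<forall>t. shift t \<in> G \<longleftrightarrow> (\<exists>i j. t = of_int i *\<^sub>R u + of_int j *\<^sub>R v))"

lemma shift_eq_iff [simp]: "shift t = shift s \<longleftrightarrow> t = s"
  by (metis add.left_neutral shift_def)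

lemma shift_conj_image:
  assumes \<phi>: "affine_bijection \<phi>" "linear L" "bij L" "\<phi> = (\<lambda>p. L p + b)"
  shows "shift (L t) \<in> conj_map \<phi> ` H \<longleftrightarrow> shift t \<in> H"
proof -
  note conj = conj_map_shift[OF affine_bijection_bij[OF \<phi>(1)] \<phi>(2,4)]
  show ?thesis
    unfolding conj[symmetric] image_iff conj_map_simps(3)[OF \<phi>(1)] by blast
qed

lemma frame_conj:
  assumes \<phi>: "affine_bijection \<phi>" and fr: "frame H g u v"
  shows "\<exists>u' v'. frame (conj_map \<phi> ` H) (conj_map \<phi> g) u' v'"
proof -
  obtain L b where L: "linear L" "bij L" "\<phi> = (\<lambda>p. L p + b)"
    using \<phi> unfolding affine_bijection_def by blast
  note bij = affine_bijection_bij[OF \<phi>]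
  have add: "\<phi> (p + w) = \<phi> p + L w" "\<phi> (p - w) = \<phi> p - L w" for p w
    using L by (simp_all add: linear_add linear_diff)
  have inv: "inv \<phi> (p + L w) = inv \<phi> p + w" for p w
    using bij add(1)[of "inv \<phi> p" w] by (metis bij_inv_eq_iff)
  have L0: "L w = 0 \<longleftrightarrow> w = 0" for w
    using L by (metis bij_is_inj injD linear_0)
  have "conj_map \<phi> g (p + L u) = conj_map \<phi> g p + L u" for p
    using fr unfolding conj_map_def o_apply inv frame_def by (metis add(1))
  moreover have "conj_map \<phi> g (p + L v) = conj_map \<phi> g p - L v" for p
    using fr unfolding conj_map_def o_apply inv frame_def by (metis add(2))
  moreover have "shift t \<in> conj_map \<phi> ` H \<longleftrightarrow> (\<exists>i j. t = of_int i *\<^sub>R L u + of_int j *\<^sub>R L v)" for t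
  proof -
    obtain s where s: "t = L s" using L(2) by (metis bij_pointE)
    have "L s = of_int i *\<^sub>R L u + of_int j *\<^sub>R L v \<longleftrightarrow> s = of_int i *\<^sub>R u + of_int j *\<^sub>R v" for i j
    proof -
      have "of_int i *\<^sub>R L u + of_int j *\<^sub>R L v = L (of_int i *\<^sub>R u + of_int j *\<^sub>R v)"
        using L(1) by (simp only: linear_add linear_scale)
      then show ?thesis using L(2) by (metis bij_is_inj injD)
    qed
    then show ?thesis
      unfolding s shift_conj_image[OF \<phi> L] using fr unfolding frame_def by blast
  qed
  ultimately have "frame (conj_map \<phi> ` H) (conj_map \<phi> g) (L u) (L v)"
    using fr unfolding frame_def L0 by blast
  then show ?thesis by blast
qed

lemma standard_shift:
  assumes "T \<in> {PM, PMM, P4M, P4G}"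
  shows "shift (a, b) \<in> standard_group T \<longleftrightarrow> (\<exists>m n. a = of_int m \<and> b = of_int n)"
proof -
  have "shift (a, b) = half_map (p, q, r, s, t + 2 * m, u + 2 * n) \<longleftrightarrow>
      p = 1 \<and> q = 0 \<and> r = 0 \<and> s = 1 \<and> a = of_int t / 2 + of_int m \<and> b = of_int u / 2 + of_int n"
    for p q r s t u m n
    by (auto simp: shift_aff half_map_def add_divide_distrib)
  then show ?thesis
    using assms unfolding standard_group_iff by (elim insertE emptyE; simp)
qed

text \<open>The translation part of the map is arbitrary, because only its linear part acts on the
  frame. This admits a glide for \<open>P4G\<close>, where no mirror is parallel to a side of the
  cell.\<close>

lemma standard_frame:
  assumes "T \<in> {PM, PMM, P4M, P4G}"
  shows "frame (standard_group T) (half_map (- 1, 0, 0, 1, t, u)) (0, 1) (1, 0)"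
  unfolding frame_def split_paired_All
  by (auto simp: half_map_def zero_prod_def standard_shift[OF assms])

lemma frame_PM:
  assumes "has_type G PM"
  shows "\<exists>m\<in>G. \<exists>u v. mirror m \<and> frame G m u v \<and> (\<forall>m'\<in>G. mirror m' \<longrightarrow> translation (m \<circ> m'))"
proof -
  obtain \<phi> where \<phi>: "affine_bijection \<phi>" and G: "G = conj_map \<phi> ` standard_group PM"
    using assms(1) by (rule has_type_conjE)
  let ?m = "half_map (- 1, 0, 0, 1, 0, 0)"
  obtain u v where fr: "frame G (conj_map \<phi> ?m) u v"
    using frame_conj[OF \<phi> standard_frame] G by blast
  have m: "?m \<in> standard_group PM" by (rule standard_group_memI) simp
  have "mirror ?m" by (simp add: mirror_def half_map_def id_aff)
  moreover have "translation (?m \<circ> g)" if "g \<in> standard_group PM" "mirror g" for g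
    using that by (auto simp: standard_group_iff half_map_def mirror_def)
  ultimately have "mirror (conj_map \<phi> ?m)" "\<forall>m'\<in>G. mirror m' \<longrightarrow> translation (conj_map \<phi> ?m \<circ> m')"
    unfolding G ball_simps conj_map_mirror[OF \<phi>] conj_map_simps[OF \<phi>] by blast+
  then show ?thesis using fr m unfolding G by blast
qed

lemma frame_PMM:
  assumes "has_type G PMM"
  shows "\<exists>m\<in>G. \<exists>u v. mirror m \<and> frame G m u v \<and>
    (\<exists>m'\<in>G. mirror m' \<and> half_turn (m \<circ> m')) \<and>
    (\<forall>g\<in>G. translation ((m \<circ> g) \<circ> (m \<circ> g)))"
proof -
  obtain \<phi> where \<phi>: "affine_bijection \<phi>" and G: "G = conj_map \<phi> ` standard_group PMM"
    using assms(1) by (rule has_type_conjE)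
  let ?m = "half_map (- 1, 0, 0, 1, 0, 0)"
  let ?m' = "half_map (1, 0, 0, - 1, 0, 0)"
  obtain u v where fr: "frame G (conj_map \<phi> ?m) u v"
    using frame_conj[OF \<phi> standard_frame] G by blast
  have m: "?m \<in> standard_group PMM" "?m' \<in> standard_group PMM"
    by (rule standard_group_memI; simp)+
  have "mirror ?m" "mirror ?m'" "half_turn (?m \<circ> ?m')" by (simp_all add: mirror_def half_map_def id_aff)
  moreover have "translation ((?m \<circ> g) \<circ> (?m \<circ> g))" if "g \<in> standard_group PMM" for g
    using that by (auto simp: standard_group_iff half_map_def)
  ultimately have "mirror (conj_map \<phi> ?m)" "mirror (conj_map \<phi> ?m')"
    "half_turn (conj_map \<phi> ?m \<circ> conj_map \<phi> ?m')"
    "\<forall>g\<in>G. translation ((conj_map \<phi> ?m \<circ> g) \<circ> (conj_map \<phi> ?m \<circ> g))"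
    unfolding G ball_simps conj_map_mirror[OF \<phi>] conj_map_simps[OF \<phi>] by blast+
  then show ?thesis using fr m unfolding G by blast
qed

text \<open>Parallel mirrors compose to translations, so the mirrors generate every map acting on
  one coordinate, and each element of pmm is a product of one such map per coordinate. This carries
  colour preservation from the mirrors to the whole group.\<close>

lemma generated_by_mirrors_PMM:
  assumes "has_type G PMM" "g \<in> G"
    and closed: "\<And>f h. f \<in> H \<Longrightarrow> h \<in> H \<Longrightarrow> f \<circ> h \<in> H"
    and mirrors: "\<And>m. m \<in> G \<Longrightarrow> mirror m \<Longrightarrow> m \<in> H"
  shows "g \<in> H"
proof -
  obtain \<phi> where \<phi>: "affine_bijection \<phi>" and G: "G = conj_map \<phi> ` standard_group PMM"
    using assms(1) by (rule has_type_conjE)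
  have mir: "conj_map \<phi> k \<in> H" if "k \<in> standard_group PMM" "mirror k" for k
    using that mirrors by (simp add: G conj_map_mirror[OF \<phi>])
  have x: "conj_map \<phi> (aff (- 1) 0 0 1 (of_int m) 0) \<in> H" for m
    by (rule mir) (auto simp: standard_group_iff half_map_def mirror_def id_aff)
  have y: "conj_map \<phi> (aff 1 0 0 (- 1) 0 (of_int n)) \<in> H" for n
    by (rule mir) (auto simp: standard_group_iff half_map_def mirror_def id_aff)
  have xx: "conj_map \<phi> (aff 1 0 0 1 (of_int m) 0) \<in> H" for m
    using closed[OF x x, of m 0] by (simp add: conj_map_simps[OF \<phi>])
  have yy: "conj_map \<phi> (aff 1 0 0 1 0 (of_int n)) \<in> H" for n
    using closed[OF y y, of n 0] by (simp add: conj_map_simps[OF \<phi>])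
  obtain k where k: "k \<in> standard_group PMM" "g = conj_map \<phi> k" using assms(2) G by blast
  then obtain p s m n where "p = 1 \<or> p = - 1" "s = 1 \<or> s = - 1" "k = aff p 0 0 s (of_int m) (of_int n)"
    by (auto simp: standard_group_iff half_map_def)
  then have "k = aff p 0 0 1 (of_int m) 0 \<circ> aff 1 0 0 s 0 (of_int n)"
    "conj_map \<phi> (aff p 0 0 1 (of_int m) 0) \<in> H" "conj_map \<phi> (aff 1 0 0 s 0 (of_int n)) \<in> H"
    using x xx y yy by auto
  then show ?thesis
    unfolding k(2) using closed conj_map_simps(5)[OF \<phi>] by metis
qed

lemma frame_P4M:
  assumes "has_type G P4M"
  shows "\<exists>m\<in>G. \<exists>u v. mirror m \<and> frame G m u v \<and>
    (\<exists>m'\<in>G. mirror m' \<and> half_turn (m \<circ> m')) \<and>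
    (\<exists>d\<in>G. mirror d \<and> half_turn ((m \<circ> d) \<circ> (m \<circ> d)))"
proof -
  obtain \<phi> where \<phi>: "affine_bijection \<phi>" and G: "G = conj_map \<phi> ` standard_group P4M"
    using assms(1) by (rule has_type_conjE)
  let ?m = "half_map (- 1, 0, 0, 1, 0, 0)"
  let ?m' = "half_map (1, 0, 0, - 1, 0, 0)"
  let ?d = "half_map (0, 1, 1, 0, 0, 0)"
  obtain u v where fr: "frame G (conj_map \<phi> ?m) u v"
    using frame_conj[OF \<phi> standard_frame] G by blast
  have m: "?m \<in> standard_group P4M" "?m' \<in> standard_group P4M" "?d \<in> standard_group P4M"
    by (rule standard_group_memI; simp)+
  have "mirror ?m" "mirror ?m'" "half_turn (?m \<circ> ?m')" "mirror ?d" "half_turn ((?m \<circ> ?d) \<circ> (?m \<circ> ?d))"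
    by (simp_all add: mirror_def half_map_def id_aff)
  then have "mirror (conj_map \<phi> ?m)" "mirror (conj_map \<phi> ?m')"
    "half_turn (conj_map \<phi> ?m \<circ> conj_map \<phi> ?m')" "mirror (conj_map \<phi> ?d)"
    "half_turn ((conj_map \<phi> ?m \<circ> conj_map \<phi> ?d) \<circ> (conj_map \<phi> ?m \<circ> conj_map \<phi> ?d))"
    unfolding conj_map_mirror[OF \<phi>] conj_map_simps[OF \<phi>] by blast+
  then show ?thesis using fr m unfolding G by blast
qed

text \<open>\<open>f\<close> is a glide along a side of the cell, while all mirrors are diagonal in
  it, so their product is a quarter turn in cell coordinates.\<close>

lemma frame_P4G:
  assumes "has_type G P4G"
  shows "\<exists>f\<in>G. \<exists>u v. frame G f u v \<and> (\<forall>m\<in>G. mirror m \<longrightarrow> half_turn ((m \<circ> f) \<circ> (m \<circ> f)))"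
proof -
  obtain \<phi> where \<phi>: "affine_bijection \<phi>" and G: "G = conj_map \<phi> ` standard_group P4G"
    using assms(1) by (rule has_type_conjE)
  let ?f = "half_map (- 1, 0, 0, 1, 1, 1)"
  obtain u v where fr: "frame G (conj_map \<phi> ?f) u v"
    using frame_conj[OF \<phi> standard_frame] G by blast
  have f: "?f \<in> standard_group P4G" by (rule standard_group_memI) simp
  have "half_turn ((m \<circ> ?f) \<circ> (m \<circ> ?f))" if "m \<in> standard_group P4G" "mirror m" for m
    using standard_mirror_P4G[OF that] unfolding linear_part_def by (auto simp: half_map_def)
  then have "\<forall>m\<in>G. mirror m \<longrightarrow> half_turn ((m \<circ> conj_map \<phi> ?f) \<circ> (m \<circ> conj_map \<phi> ?f))"
    unfolding G ball_simps conj_map_mirror[OF \<phi>] conj_map_simps[OF \<phi>] by blast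
  then show ?thesis using fr f unfolding G by blast
qed

text \<open>Conversely, the lattice of a group of type \<^const>\<open>CMM\<close> is not rectangular.\<close>

lemma centred_CMM:
  assumes "has_type G CMM" "m \<in> G" "mirror m"
  shows "\<exists>t. shift t \<in> G \<and> (\<forall>s. shift s \<in> G \<longrightarrow> s + s \<noteq> t + (m t - m 0))"
proof -
  obtain \<phi> where \<phi>: "affine_bijection \<phi>" and G: "G = conj_map \<phi> ` standard_group CMM"
    using assms(1) by (rule has_type_conjE)
  obtain L b where L: "linear L" "bij L" "\<phi> = (\<lambda>p. L p + b)"
    using \<phi> unfolding affine_bijection_def by blast
  obtain g where g: "g \<in> standard_group CMM" "m = conj_map \<phi> g" using assms(2) G by blast
  have bij: "bij \<phi>" by (rule affine_bijection_bij[OF \<phi>])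
  have "mirror g" using assms(3) g by (simp add: conj_map_mirror[OF \<phi>])
  then have lin: "linear_part g (- 1) 0 0 1 \<or> linear_part g 1 0 0 (- 1)"
    using standard_mirror_CMM[OF g(1)] by blast
  \<comment> \<open>The centring translation is the witness: its component fixed by the mirror is
    half a side of the cell, which is no lattice vector.\<close>
  have half: "shift (1/2, 1/2) \<in> standard_group CMM"
    using standard_group_memI[of "(1, 0, 0, 1, 1, 1)" CMM] by (simp add: shift_aff half_map_def)
  have "s + s \<noteq> (1/2, 1/2) + (g (1/2, 1/2) - g 0)" if s: "shift s \<in> standard_group CMM" for s
  proof -
    obtain x y where xy: "s = (x, y)" by fastforce
    \<comment> \<open>Twice a lattice vector has coordinates of equal parity, whereas the vector to
      be avoided is \<open>(0, 1)\<close> or \<open>(1, 0)\<close>.\<close>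
    have "\<exists>i j. x + x = of_int i \<and> y + y = of_int j \<and> even (i - j)"
    proof -
      from s obtain m n where "(x = of_int m \<and> y = of_int n) \<or> (x = 1/2 + of_int m \<and> y = 1/2 + of_int n)"
        by (auto simp: xy shift_aff standard_group_iff half_map_def add_divide_distrib)
      then show ?thesis
      proof
        assume "x = of_int m \<and> y = of_int n"
        then show ?thesis by (intro exI[of _ "2 * m"] exI[of _ "2 * n"]) simp
      next
        assume "x = 1/2 + of_int m \<and> y = 1/2 + of_int n"
        then show ?thesis by (intro exI[of _ "1 + 2 * m"] exI[of _ "1 + 2 * n"]) simp
      qed
    qed
    then obtain i j where ij: "x + x = of_int i" "y + y = of_int j" "even (i - j)" by blast
    show ?thesis
    proof
      assume "s + s = (1/2, 1/2) + (g (1/2, 1/2) - g 0)"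
      then have "(real_of_int i = 0 \<and> real_of_int j = 1) \<or> (real_of_int i = 1 \<and> real_of_int j = 0)"
        using lin unfolding linear_part_def by (auto simp: xy ij zero_prod_def)
      then have "(i = 0 \<and> j = 1) \<or> (i = 1 \<and> j = 0)" by (simp only: of_int_eq_0_iff of_int_eq_1_iff)
      then show False using ij(3) by auto
    qed
  qed
  moreover have "L w + (m (L w) - m 0) = L (w + (g w - g 0))" for w
  proof -
    have "g (p + w) - g p = g w - g 0" for p
      using lin unfolding linear_part_def by (cases p; cases w) (auto simp: zero_prod_def)
    then have "g (inv \<phi> 0 + w) = g (inv \<phi> 0) + (g w - g 0)" by (metis add.commute diff_add_cancel)
    moreover have "\<phi> (inv \<phi> 0 + w) = \<phi> (inv \<phi> 0) + L w"
      using L by (simp add: linear_add)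
    then have "inv \<phi> (L w) = inv \<phi> 0 + w"
      using bij by (metis add.left_neutral bij_inv_eq_iff)
    ultimately have "m (L w) = \<phi> (g (inv \<phi> 0) + (g w - g 0))" by (simp add: g(2) conj_map_def)
    also have "\<dots> = m 0 + L (g w - g 0)"
      by (simp add: g(2) conj_map_def L(3) linear_add[OF L(1)])
    finally show ?thesis by (simp add: linear_add[OF L(1)])
  qed
  ultimately have "shift (L (1/2, 1/2)) \<in> G"
    and no: "shift (L s) \<in> G \<Longrightarrow> s + s \<noteq> (1/2, 1/2) + (g (1/2, 1/2) - g 0)"
    and eq: "L w + (m (L w) - m 0) = L (w + (g w - g 0))" for s w
    using half unfolding G shift_conj_image[OF \<phi> L] by blast+
  moreover have "r + r \<noteq> L (1/2, 1/2) + (m (L (1/2, 1/2)) - m 0)" if r: "shift r \<in> G" for r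
  proof
    assume r2: "r + r = L (1/2, 1/2) + (m (L (1/2, 1/2)) - m 0)"
    obtain s where s: "r = L s" using L(2) by (metis bij_pointE)
    have "L (s + s) = L ((1/2, 1/2) + (g (1/2, 1/2) - g 0))"
      using r2 unfolding eq by (simp only: s linear_add[OF L(1)])
    then show False using no r L(2) unfolding s by (metis bij_is_inj injD)
  qed
  ultimately show ?thesis by blast
qed

section \<open>Reflections and translations of stitch patterns\<close>

lemma image_comp_stitches:
  "(\<lambda>u. (f \<circ> g) ` u) ` A = (\<lambda>u. f ` u) ` (\<lambda>u. g ` u) ` A"
  by (simp add: image_image image_comp)

lemma isometry_comp: "isometry f \<Longrightarrow> isometry g \<Longrightarrow> isometry (f \<circ> g)"
  unfolding isometry_def o_apply by metis

lemma symmetries_comp: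
  "f \<in> symmetries x y \<Longrightarrow> g \<in> symmetries x y \<Longrightarrow> f \<circ> g \<in> symmetries x y"
  "f \<in> symmetries x y \<Longrightarrow> g \<in> flip_symmetries x y \<Longrightarrow> f \<circ> g \<in> flip_symmetries x y"
  "f \<in> flip_symmetries x y \<Longrightarrow> g \<in> symmetries x y \<Longrightarrow> f \<circ> g \<in> flip_symmetries x y"
  "f \<in> flip_symmetries x y \<Longrightarrow> g \<in> flip_symmetries x y \<Longrightarrow> f \<circ> g \<in> symmetries x y"
  unfolding symmetries_def flip_symmetries_def mem_Collect_eq image_comp_stitches
  by (elim conjE, intro conjI, rule isometry_comp, assumption, assumption, simp only:, simp only:)+

lemma flip_not_symmetry: "f \<in> flip_symmetries x y \<Longrightarrow> f \<notin> symmetries x y"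
proof
  assume "f \<in> flip_symmetries x y" "f \<in> symmetries x y"
  then have "front_stitches x y = back_stitches x y"
    unfolding flip_symmetries_def symmetries_def mem_Collect_eq by (elim conjE) (simp only:)
  then have "edge ` {k. odd (colour x y k)} = edge ` {k. even (colour x y k)}"
    by (simp only: front_stitches_colour back_stitches_colour)
  then have "{k. odd (colour x y k)} = {k. even (colour x y k)}"
    by (rule inj_image_eq_iff[THEN iffD1, rotated]) (simp add: inj_def)
  then show False by blast
qed

definition stitch_isometries :: "(int \<Rightarrow> int) \<Rightarrow> (int \<Rightarrow> int) \<Rightarrow> (plane \<Rightarrow> plane) set" where
  "stitch_isometries x y = symmetries x y \<union> flip_symmetries x y"

lemma stitch_isometries_comp:
  "f \<in> stitch_isometries x y \<Longrightarrow> g \<in> stitch_isometries x y \<Longrightarrow> f \<circ> g \<in> stitch_isometries x y"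
  unfolding stitch_isometries_def using symmetries_comp by blast

lemma grid_map_eq_iff:
  assumes "s \<in> unit_signs" "s' \<in> unit_signs"
  shows "grid_map sw s t a b = grid_map sw' s' t' a' b' \<longleftrightarrow>
    sw = sw' \<and> s = s' \<and> t = t' \<and> a = a' \<and> b = b'"
  using assms by (auto simp: grid_map_def unit_signs_def)

lemma grid_map_symmetries:
  assumes "s \<in> unit_signs"
  shows "grid_map sw s t a b \<in> symmetries x y \<longleftrightarrow> sym_cond x y 0 sw s t a b"
    and "grid_map sw s t a b \<in> flip_symmetries x y \<longleftrightarrow> sym_cond x y 1 sw s t a b"
proof -
  have "(\<exists>sw' s' t' a' b'. grid_map sw s t a b = grid_map sw' s' t' a' b' \<and> sym_cond x y e sw' s' t' a' b')
      \<longleftrightarrow> sym_cond x y e sw s t a b" for e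
  proof -
    have "sym_cond x y e sw s t a b"
      if "grid_map sw s t a b = grid_map sw' s' t' a' b'" "sym_cond x y e sw' s' t' a' b'"
      for sw' s' t' a' b'
    proof -
      have "s' \<in> unit_signs" using that(2) by (simp only: sym_cond_def)
      then show ?thesis using that by (simp only: grid_map_eq_iff[OF assms])
    qed
    then show ?thesis by blast
  qed
  then show "grid_map sw s t a b \<in> symmetries x y \<longleftrightarrow> sym_cond x y 0 sw s t a b"
    and "grid_map sw s t a b \<in> flip_symmetries x y \<longleftrightarrow> sym_cond x y 1 sw s t a b"
    by (simp_all only: symmetries_eq flip_symmetries_eq mem_Collect_eq)
qed

lemma grid_map_isometries:
  assumes "s \<in> unit_signs"
  shows "grid_map sw s t a b \<in> stitch_isometries x y \<longleftrightarrow> (\<exists>e. sym_cond x y e sw s t a b)"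
proof -
  have "(\<exists>e. sym_cond x y e sw s t a b) \<longleftrightarrow> sym_cond x y 0 sw s t a b \<or> sym_cond x y 1 sw s t a b"
  proof
    assume "\<exists>e. sym_cond x y e sw s t a b"
    then obtain e where e: "sym_cond x y e sw s t a b" by blast
    show "sym_cond x y 0 sw s t a b \<or> sym_cond x y 1 sw s t a b"
    proof (cases "even e")
      case True
      then show ?thesis using e sym_cond_parity[of e 0] by simp
    next
      case False
      then show ?thesis using e sym_cond_parity[of e 1] by simp
    qed
  qed blast
  then show ?thesis
    unfolding stitch_isometries_def Un_iff grid_map_symmetries[OF assms] by blast
qed

lemma stitch_isometriesE:
  assumes "f \<in> stitch_isometries x y"
  obtains e sw s t a b where "f = grid_map sw s t a b" "sym_cond x y e sw s t a b"
    "s \<in> {1, - 1}" "t \<in> {1, - 1}"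
proof -
  have "\<exists>e sw s t a b. f = grid_map sw s t a b \<and> sym_cond x y e sw s t a b"
    using assms unfolding stitch_isometries_def symmetries_eq flip_symmetries_eq by blast
  then show ?thesis using that unfolding sym_cond_def unit_signs_def by blast
qed

lemma translation_grid_map:
  "translation (grid_map sw s t a b) \<longleftrightarrow> \<not> sw \<and> s = 1 \<and> t = 1"
  "half_turn (grid_map sw s t a b) \<longleftrightarrow> \<not> sw \<and> s = - 1 \<and> t = - 1"
proof -
  have "real_of_int k = - 1 \<longleftrightarrow> k = - 1" for k
    by (metis of_int_1 of_int_eq_iff of_int_minus)
  then show "translation (grid_map sw s t a b) \<longleftrightarrow> \<not> sw \<and> s = 1 \<and> t = 1"
    "half_turn (grid_map sw s t a b) \<longleftrightarrow> \<not> sw \<and> s = - 1 \<and> t = - 1"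
    by (simp_all add: grid_map_def)
qed

lemma grid_map_comp:
  "grid_map sw s t a b \<circ> grid_map sw' s' t' a' b' =
    (if sw then grid_map (\<not> sw') (s * t') (t * s') (s * b' + a) (t * a' + b)
     else grid_map sw' (s * s') (t * t') (s * a' + a) (t * b' + b))"
  by (simp add: grid_map_def)

lemma shift_grid_map: "shift (of_int a, of_int b) = grid_map False 1 1 a b"
  by (simp add: shift_aff grid_map_def)

lemma grid_map_id: "id = grid_map False 1 1 0 0"
  by (simp add: id_aff grid_map_def)

lemma unit_signs_simps [simp]: "1 \<in> unit_signs" "- 1 \<in> unit_signs"
  by (simp_all add: unit_signs_def)

text \<open>The equations for \<open>a\<close> and \<open>b\<close> say that nothing is translated
  along the axis; with the same signs, any other translation part gives a glide.\<close>

lemma mirror_grid_map: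
  assumes "s \<in> {1, - 1}" "t \<in> {1, - 1}"
  shows "mirror (grid_map sw s t a b) \<longleftrightarrow>
    (if sw then s = t \<and> a = - s * b else s = - t \<and> (if s = 1 then a = 0 else b = 0))"
proof -
  have "s * t \<in> unit_signs" "s * s \<in> unit_signs"
    using assms by (auto simp: unit_signs_def)
  then show ?thesis
    using assms unfolding mirror_def grid_map_comp grid_map_id translation_grid_map
    by (auto simp: grid_map_eq_iff)
qed

lemma shift_isometriesE:
  assumes "shift p \<in> stitch_isometries x y"
  obtains e a b where "p = (of_int a, of_int b)" "sym_cond x y e False 1 1 a b"
proof -
  obtain e sw s t a b where f: "shift p = grid_map sw s t a b" "sym_cond x y e sw s t a b"
    using assms by (rule stitch_isometriesE)
  have "translation (grid_map sw s t a b)" unfolding f(1)[symmetric] translation_def by blast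
  then have st: "sw = False" "s = 1" "t = 1" by (simp_all add: translation_grid_map)
  have "shift p = shift (of_int a, of_int b)" using f(1) by (simp only: shift_grid_map st)
  then have "p = (of_int a, of_int b)" by simp
  with f(2) that show ?thesis unfolding st by blast
qed

section \<open>Reflections forced by parity\<close>

lemma agreeD: "agree s u v a c \<Longrightarrow> even (u (s * i + a) + v i + c)"
  by (simp add: agree_def)

text \<open>For even \<open>a\<close> the reversal fixes the index \<open>a div 2\<close>, where
  \<open>u\<close> is compared with itself.\<close>

lemma no_even_centre: "agree (- 1) u u a c \<Longrightarrow> even a \<Longrightarrow> even c"
proof -
  assume *: "agree (- 1) u u a c" "even a"
  then obtain k where "a = 2 * k" by blast
  with agreeD[OF *(1), of k] show "even c" by simp
qed

lemma axis_mirror_symmetry: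
  assumes "f \<in> stitch_isometries x y" "mirror f" "f = grid_map False s t a b"
    "s \<in> {1, - 1}" "t \<in> {1, - 1}"
  shows "f \<in> symmetries x y"
proof -
  have s: "s \<in> unit_signs" using assms(4) by (auto simp: unit_signs_def)
  have "f \<notin> flip_symmetries x y"
  proof
    assume "f \<in> flip_symmetries x y"
    then have cond: "sym_cond x y 1 False s t a b" using assms(3) grid_map_symmetries[OF s] by simp
    have m: "s = - t" "if s = 1 then a = 0 else b = 0"
      using assms(2) mirror_grid_map[OF assms(4,5)] unfolding assms(3) by (simp_all split: if_splits)
    show False
    proof (cases "s = 1")
      case True
      \<comment> \<open>Gridlines perpendicular to the axis are mapped to themselves; reversing
        their colours makes \<open>b\<close> even. Then the axis is a gridline, whose stitches are
        fixed.\<close>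
      then have "agree 1 x x 0 (b + 1 + 1)" "agree (- 1) y y b (0 + 1 + 0)"
        using m cond by (auto simp: sym_cond_def turn_def)
      then show False using agreeD[of 1 x x 0 "b + 1 + 1" 0] no_even_centre[of y b "0 + 1 + 0"]
        by auto
    next
      case False
      then have "s = - 1" "t = 1" "b = 0" using m assms(4) by auto
      then have "agree (- 1) x x a (0 + 1 + 0)" "agree 1 y y 0 (a + 1 + 1)"
        using cond by (auto simp: sym_cond_def turn_def)
      then show False using agreeD[of 1 y y 0 "a + 1 + 1" 0] no_even_centre[of x a "0 + 1 + 0"]
        by auto
    qed
  qed
  then show ?thesis using assms(1) by (simp add: stitch_isometries_def)
qed

definition has_axis_mirror :: "(int \<Rightarrow> int) \<Rightarrow> (int \<Rightarrow> int) \<Rightarrow> bool" where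
  "has_axis_mirror x y \<longleftrightarrow>
    (\<exists>m\<in>symmetries x y. mirror m \<and> (\<exists>s a b. s \<in> {1, - 1} \<and> m = grid_map False s (- s) a b))"

text \<open>By \<open>no_even_centre\<close>, \<open>c\<close> is odd and the axis lies halfway
  between two gridlines. The word \<open>y\<close> only has to agree with itself, so a condition on
  \<open>x\<close> alone suffices.\<close>

lemma axis_mirror_x:
  assumes "agree (- 1) x x c (c + 1)"
  shows "has_axis_mirror x y"
proof -
  have "odd c" using no_even_centre[OF assms] by auto
  have "agree (- 1) x x c 0"
    using assms \<open>odd c\<close> agree_parity[of "c + 1" 0 "- 1" x x c] by simp
  moreover have "agree 1 y y 0 (c + 1)" using \<open>odd c\<close> by (simp add: agree_def)
  ultimately have "sym_cond x y 0 False (- 1) 1 c 0"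
    by (simp add: sym_cond_def turn_def)
  then have "grid_map False (- 1) 1 c 0 \<in> symmetries x y" by (simp add: grid_map_symmetries)
  moreover have "mirror (grid_map False (- 1) 1 c 0)" by (simp add: mirror_grid_map)
  ultimately show ?thesis unfolding has_axis_mirror_def by (metis insertCI minus_minus)
qed

lemma axis_mirror_y:
  assumes "agree (- 1) y y c (c + 1)"
  shows "has_axis_mirror x y"
proof -
  have "odd c" using no_even_centre[OF assms] by auto
  have "agree (- 1) y y c 0"
    using assms \<open>odd c\<close> agree_parity[of "c + 1" 0 "- 1" y y c] by simp
  moreover have "agree 1 x x 0 (c + 1)" using \<open>odd c\<close> by (simp add: agree_def)
  ultimately have "sym_cond x y 0 False 1 (- 1) 0 c"
    by (simp add: sym_cond_def turn_def)
  then have "grid_map False 1 (- 1) 0 c \<in> symmetries x y" by (simp add: grid_map_symmetries)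
  moreover have "mirror (grid_map False 1 (- 1) 0 c)" by (simp add: mirror_grid_map)
  ultimately show ?thesis unfolding has_axis_mirror_def by (metis insertCI)
qed

text \<open>In the condition that the square of the quarter turn imposes on \<open>x\<close>, the
  effect \<open>e\<close> enters twice and exactly one sign contributes a turn. This is the parity
  that \<open>axis_mirror_x\<close> requires.\<close>

lemma quarter_turn_axis_mirror:
  assumes "grid_map True s (- s) a b \<in> stitch_isometries x y" "s \<in> {1, - 1}"
  shows "has_axis_mirror x y"
proof -
  have "s \<in> unit_signs" using assms(2) by (auto simp: unit_signs_def)
  then obtain e where "sym_cond x y e True s (- s) a b"
    using assms(1) grid_map_isometries by blast
  then have "agree s x y a (b + e + turn (- s))" "agree (- s) y x b (a + e + turn s)"
    by (simp_all add: sym_cond_def)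
  from agree_comp[OF this]
  have "agree (- 1) x x (s * b + a) (b + e + turn (- s) + (a + e + turn s))" using assms(2) by auto
  moreover have "even (b + e + turn (- s) + (a + e + turn s) - (s * b + a + 1))"
    using assms(2) by (auto simp: turn_def)
  ultimately have "agree (- 1) x x (s * b + a) (s * b + a + 1)"
    using agree_parity by blast
  then show ?thesis by (rule axis_mirror_x)
qed

lemma agree_inverse:
  assumes "agree s u v a c" "s \<in> {1, - 1}"
  shows "agree s v u (- s * a) c"
  unfolding agree_def
proof
  fix i
  have "even (u (s * (s * i + - s * a) + a) + v (s * i + - s * a) + c)" using assms(1) by (simp only: agree_def)
  moreover have "s * (s * i + - s * a) + a = i" using assms(2) by auto
  ultimately have "even (u i + v (s * i + - s * a) + c)" by (simp only:)
  then show "even (v (s * i + - s * a) + u i + c)" by (simp only: add.commute[of "u i"])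
qed

lemma sign_unit: "s \<in> {1, - 1} \<Longrightarrow> s \<in> unit_signs"
  by (simp add: unit_signs_def)

text \<open>Only the second of the two conditions is kept; its inverse replaces the first. Thus a
  diagonal glide comes with a mirror of the same direction, whose colour effect is the parity of
  \<open>a + b + e\<close>.\<close>

lemma swap_mirror:
  assumes "sym_cond x y e True s s a b"
  shows "sym_cond x y (a + b + e) True s s (- s * b) b"
proof -
  have s: "s \<in> unit_signs" "s \<in> {1, - 1}" and yx: "agree s y x b (a + e + turn s)"
    using assms by (simp_all add: sym_cond_def unit_signs_def)
  have "even (a + e + turn s - (b + (a + b + e) + turn s))"
    "even (a + e + turn s - (- s * b + (a + b + e) + turn s))"
    using s(2) by auto
  then have "agree s x y (- s * b) (b + (a + b + e) + turn s)"
    "agree s y x b (- s * b + (a + b + e) + turn s)"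
    using agree_inverse[OF yx s(2)] yx agree_parity by blast+
  then show ?thesis using s(1) by (simp add: sym_cond_def)
qed

lemma mirror_symmetry_if_even:
  assumes "sym_cond x y e True s s (- s * b) b" "even e"
  shows "\<exists>m\<in>symmetries x y. mirror m"
proof -
  have s: "s \<in> {1, - 1}" using assms(1) by (simp add: sym_cond_def unit_signs_def)
  have "sym_cond x y 0 True s s (- s * b) b" using assms sym_cond_parity[of e 0] by simp
  then have "grid_map True s s (- s * b) b \<in> symmetries x y"
    using grid_map_symmetries[OF sign_unit[OF s]] by blast
  moreover have "mirror (grid_map True s s (- s * b) b)" using mirror_grid_map[OF s s] by simp
  ultimately show ?thesis by blast
qed

text \<open>Composing the two mirrors from \<open>swap_mirror\<close> gives a reversal of
  \<open>x\<close> whose parity depends on the sum of their colour effects. Equal effects yield an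
  axis-parallel mirror; otherwise one of the two mirrors preserves colours, and the last alternative
  records the parity for \<open>axis_isometry\<close>.\<close>

lemma diagonal_centre:
  assumes "sym_cond x y e True 1 1 a b" "sym_cond x y e' True (- 1) (- 1) a' b'"
  shows "(\<exists>m\<in>symmetries x y. mirror m) \<and> (has_axis_mirror x y \<or> (\<exists>c. agree (- 1) x x c c))"
proof -
  define f where "f = a + b + e"
  define f' where "f' = a' + b' + e'"
  have 1: "sym_cond x y f True 1 1 (- 1 * b) b" unfolding f_def by (rule swap_mirror[OF assms(1)])
  have 2: "sym_cond x y f' True (- 1) (- 1) (- (- 1) * b') b'" unfolding f'_def by (rule swap_mirror[OF assms(2)])
  have "agree 1 x y (- b) (b + f)" "agree (- 1) y x b' (b' + f' + 1)"
    using 1 2 by (simp_all add: sym_cond_def turn_def)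
  from agree_comp[OF this] have x: "agree (- 1) x x (b' - b) (b + f + (b' + f' + 1))" by simp
  show ?thesis
  proof (cases "even (f + f')")
    case True
    have "even (b + f + (b' + f' + 1) - (b' - b + 1))" using True by simp
    then have "agree (- 1) x x (b' - b) (b' - b + 1)" using x agree_parity by blast
    then have "has_axis_mirror x y" by (rule axis_mirror_x)
    then show ?thesis unfolding has_axis_mirror_def by blast
  next
    case False
    then have "even f \<or> even f'" by simp
    then have "\<exists>m\<in>symmetries x y. mirror m"
      using mirror_symmetry_if_even[OF 1] mirror_symmetry_if_even[OF 2] by blast
    moreover have "even (b + f + (b' + f' + 1) - (b' - b))" using False by simp
    then have "agree (- 1) x x (b' - b) (b' - b)" using x agree_parity by blast
    ultimately show ?thesis by blast
  qed
qed

text \<open>Each isometry gives an axis-parallel mirror unless its parity is wrong. If both are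
  wrong, moving the centre of the reversal of \<open>x\<close> by the translation part
  \<open>a'\<close> of the other isometry repairs the parity.\<close>

lemma axis_pair_mirror:
  assumes "sym_cond x y e False (- 1) 1 a b" "sym_cond x y e' False 1 (- 1) a' b'"
  shows "has_axis_mirror x y"
proof -
  have x: "agree (- 1) x x a (b + e)" "agree 1 x x a' (b' + e' + 1)" and y: "agree (- 1) y y b' (a' + e')"
    using assms by (simp_all add: sym_cond_def turn_def)
  consider "odd (b + e - a)" | "odd (a' + e' - b')" | "even (b + e - a)" "even (a' + e' - b')" by blast
  then show ?thesis
  proof cases
    case 1
    then have "even (b + e - (a + 1))" by simp
    then have "agree (- 1) x x a (a + 1)" using x(1) agree_parity by blast
    then show ?thesis by (rule axis_mirror_x)
  next
    case 2
    then have "even (a' + e' - (b' + 1))" by simp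
    then have "agree (- 1) y y b' (b' + 1)" using y agree_parity by blast
    then show ?thesis by (rule axis_mirror_y)
  next
    case 3
    have "agree (- 1) x x (a + a') (b' + e' + 1 + (b + e))" using agree_comp[OF x(2,1)] by simp
    moreover have "even (b' + e' + 1 + (b + e) - (a + a' + 1))" using 3 by simp argo
    ultimately have "agree (- 1) x x (a + a') (a + a' + 1)" using agree_parity by blast
    then show ?thesis by (rule axis_mirror_x)
  qed
qed

text \<open>Composition with the half turn negates both signs, so a reflection or glide comes with a
  perpendicular one. The remaining case is a quarter turn.\<close>

lemma mirror_of_half_turn:
  assumes "h \<in> stitch_isometries x y" "half_turn h"
    and "f \<in> stitch_isometries x y" "\<not> translation f" "\<not> half_turn f"
  shows "\<exists>m\<in>symmetries x y. mirror m"
proof -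
  obtain e sw s t a b where f: "f = grid_map sw s t a b" "sym_cond x y e sw s t a b"
    and st: "s \<in> {1, - 1}" "t \<in> {1, - 1}" using assms(3) by (rule stitch_isometriesE)
  obtain e' sw' s' t' c d where h: "h = grid_map sw' s' t' c d"
    using assms(1) by (rule stitch_isometriesE)
  then have h: "h = grid_map False (- 1) (- 1) c d"
    using assms(2) by (simp add: translation_grid_map)
  have "f \<circ> h \<in> stitch_isometries x y" using assms(1,3) by (simp add: stitch_isometries_comp)
  moreover obtain a' b' where fh: "f \<circ> h = grid_map sw (- s) (- t) a' b'"
    by (cases sw) (simp_all add: f h grid_map_comp)
  moreover have "- s \<in> unit_signs" using st by (auto simp: unit_signs_def)
  ultimately obtain e' where e': "sym_cond x y e' sw (- s) (- t) a' b'"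
    using grid_map_isometries by metis
  have axis: "\<exists>m\<in>symmetries x y. mirror m" if "has_axis_mirror x y"
    using that unfolding has_axis_mirror_def by blast
  show ?thesis
  proof (cases sw)
    case True
    show ?thesis
    proof (cases "s = t")
      case True
      then show ?thesis
        using diagonal_centre[of x y e a b e' a' b'] diagonal_centre[of x y e' a' b' e a b]
          \<open>sw\<close> st f(2) e' by auto
    next
      case False
      then have "t = - s" using st by auto
      then have "has_axis_mirror x y"
        using quarter_turn_axis_mirror[of s a b x y] assms(3) st \<open>sw\<close> by (simp add: f(1))
      then show ?thesis by (rule axis)
    qed
  next
    case False
    then have "s = 1 \<and> t = - 1 \<or> s = - 1 \<and> t = 1"
      using assms(4,5) st by (auto simp: f(1) translation_grid_map)
    then have "has_axis_mirror x y"
      using f(2) e' False axis_pair_mirror[of x y] by auto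
    then show ?thesis by (rule axis)
  qed
qed

section \<open>Translations and diagonal lattices\<close>

lemma diagonal_shift_symmetry:
  assumes "shift (of_int a, of_int b) \<in> symmetries x y" "even (a - b)"
  shows "shift (of_int a, 0) \<in> stitch_isometries x y"
proof -
  have "sym_cond x y 0 False 1 1 a b"
    using assms(1) unfolding shift_grid_map by (simp add: grid_map_symmetries)
  then have "agree 1 x x a b" by (simp add: sym_cond_def turn_def)
  \<comment> \<open>The condition on \<open>x\<close> sees only the parity of \<open>b\<close>,
    which is that of \<open>a\<close>. Replacing the shift \<open>b\<close> by 0 is compensated by
    the colour effect \<open>a\<close>, and the same effect validates the trivial condition on
    \<open>y\<close>.\<close>
  moreover have "even (b - (0 + a + turn 1))" using assms(2) by (simp add: turn_def)
  ultimately have "agree 1 x x a (0 + a + turn 1)" using agree_parity by blast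
  moreover have "agree 1 y y 0 (a + a + turn 1)" by (simp add: agree_def turn_def)
  ultimately have "sym_cond x y a False 1 1 a 0" by (simp add: sym_cond_def)
  then have "grid_map False 1 1 a 0 \<in> stitch_isometries x y"
    using grid_map_isometries[of 1] unit_signs_simps by blast
  then show ?thesis unfolding shift_grid_map[symmetric] by simp
qed

text \<open>Inverting the shift of \<open>y\<close> keeps its parity, and \<open>x\<close> sees only
  the parity of the second component.\<close>

lemma shift_flip_reflect:
  assumes "shift (p, q) \<in> flip_symmetries x y"
  shows "shift (p, - q) \<in> flip_symmetries x y"
proof -
  have "shift (p, q) \<in> stitch_isometries x y" using assms by (simp add: stitch_isometries_def)
  then obtain a b where ab: "(p, q) = (real_of_int a, real_of_int b)" by (rule shift_isometriesE)
  have "sym_cond x y 1 False 1 1 a b"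
    using assms unfolding ab shift_grid_map by (simp add: grid_map_symmetries)
  then have x: "agree 1 x x a (b + 1)" and y: "agree 1 y y b (a + 1)" by (simp_all add: sym_cond_def turn_def)
  have "agree 1 x x a (- b + 1)" using x agree_parity[of "b + 1" "- b + 1" 1 x x a] by simp
  moreover have "agree 1 y y (- b) (a + 1)"
    using agree_neg[OF y] agree_parity[of "- (a + 1)" "a + 1" 1 y y "- b"] by simp
  ultimately have "sym_cond x y 1 False 1 1 a (- b)" by (simp add: sym_cond_def turn_def)
  then have "grid_map False 1 1 a (- b) \<in> flip_symmetries x y" by (simp add: grid_map_symmetries)
  then show ?thesis using ab by (simp add: shift_grid_map[symmetric])
qed

lemma frame_diagonal:
  assumes fr: "frame G (grid_map True s t a b) u v" and st: "s \<in> {1, - 1}" "t \<in> {1, - 1}"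
  obtains h k where "t = s" "u = (h, of_int s * h)" "v = (k, - of_int s * k)" "h \<noteq> 0" "k \<noteq> 0"
proof -
  let ?f = "grid_map True s t a b"
  have u: "?f (0 + u) = ?f 0 + u" "u \<noteq> 0" and v: "?f (0 + v) = ?f 0 - v" "v \<noteq> 0"
    using fr unfolding frame_def by blast+
  obtain u1 u2 v1 v2 where uv: "u = (u1, u2)" "v = (v1, v2)" by fastforce
  have 1: "of_int s * u2 = u1" "of_int t * u1 = u2" "of_int s * v2 = - v1" "of_int t * v1 = - v2"
    using u(1) v(1) by (auto simp: uv grid_map_def zero_prod_def)
  have "t = s" using 1 u(2) st by (auto simp: uv zero_prod_def)
  moreover have "u2 = of_int s * u1" "v2 = - of_int s * v1" using 1 st by auto
  moreover have "u1 \<noteq> 0" "v1 \<noteq> 0" using calculation u(2) v(2) by (auto simp: uv zero_prod_def)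
  ultimately show ?thesis using that uv by blast
qed

lemma frame_axis:
  assumes fr: "frame G (grid_map False s (- s) a b) u v" and s: "s \<in> {1, - 1}"
  shows "if s = 1 then \<exists>h k. u = (h, 0) \<and> v = (0, k) \<and> h \<noteq> 0 \<and> k \<noteq> 0
    else \<exists>h k. u = (0, h) \<and> v = (k, 0) \<and> h \<noteq> 0 \<and> k \<noteq> 0"
proof -
  let ?f = "grid_map False s (- s) a b"
  have u: "?f (0 + u) = ?f 0 + u" "u \<noteq> 0" and v: "?f (0 + v) = ?f 0 - v" "v \<noteq> 0"
    using fr unfolding frame_def by blast+
  obtain u1 u2 v1 v2 where uv: "u = (u1, u2)" "v = (v1, v2)" by fastforce
  show ?thesis using u v s by (auto simp: uv grid_map_def zero_prod_def)
qed

lemma frame_shift: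
  assumes "frame G f u v"
  shows "shift (of_int i *\<^sub>R u + of_int j *\<^sub>R v) \<in> G" "shift u \<in> G" "shift v \<in> G"
proof -
  show *: "shift (of_int i *\<^sub>R u + of_int j *\<^sub>R v) \<in> G" for i j using assms unfolding frame_def by blast
  show "shift u \<in> G" using *[of 1 0] by simp
  show "shift v \<in> G" using *[of 0 1] by simp
qed

lemma frameE:
  assumes "frame G f u v" "shift t \<in> G"
  obtains i j where "t = of_int i *\<^sub>R u + of_int j *\<^sub>R v"
  using assms unfolding frame_def by blast

text \<open>
  If a diagonal translation \<open>(h, h)\<close> preserved colours, then the words would agree with their
  shifts by \<open>h\<close> in such a way that \<open>(h, 0)\<close> becomes a translation of the pattern, which the lattice
  spanned by \<open>u\<close> and \<open>v\<close> does not contain.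
\<close>

lemma diagonal_frame_flips:
  assumes fr: "frame (stitch_isometries x y) (grid_map True s t a b) u v"
    and st: "s \<in> {1, - 1}" "t \<in> {1, - 1}"
  shows "shift u \<in> flip_symmetries x y" "shift v \<in> flip_symmetries x y"
proof -
  obtain h k where uv: "u = (h, of_int s * h)" "v = (k, - of_int s * k)" and nz: "h \<noteq> 0" "k \<noteq> 0"
    using frame_diagonal[OF fr st] by metis
  have no: "shift w \<notin> symmetries x y" if w: "w = u \<or> w = v" for w
  proof
    assume S: "shift w \<in> symmetries x y"
    then have "shift w \<in> stitch_isometries x y" by (simp add: stitch_isometries_def)
    then obtain c d where cd: "w = (real_of_int c, real_of_int d)" by (rule shift_isometriesE)
    have "real_of_int d = of_int c \<or> real_of_int d = of_int (- c)"
      using w st by (auto simp: cd uv)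
    then have "d = c \<or> d = - c" by (simp only: of_int_eq_iff)
    then have "even (c - d)" by auto
    then have "shift (of_int c, 0) \<in> stitch_isometries x y"
      using diagonal_shift_symmetry S unfolding cd by blast
    then obtain i j where ij: "(real_of_int c, 0) = of_int i *\<^sub>R u + of_int j *\<^sub>R v"
      using frameE[OF fr] by metis
    then have "real_of_int c = of_int i * h + of_int j * k" "of_int i * h = of_int j * k"
      using st by (auto simp: uv)
    moreover have "real_of_int c = h \<or> real_of_int c = k" using w by (auto simp: cd uv)
    \<comment> \<open>The vector \<open>(c, 0)\<close> is half of \<open>w\<close> plus a multiple
      of the other basis vector, so its coefficient at \<open>w\<close> is not integral.\<close>
    ultimately have "h = real_of_int (2 * i) * h \<or> k = real_of_int (2 * j) * k" by auto
    then have "real_of_int (2 * i) = real_of_int 1 \<or> real_of_int (2 * j) = real_of_int 1"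
      using nz by auto
    then have "2 * i = 1 \<or> 2 * j = 1" by (simp only: of_int_eq_iff)
    then show False by presburger
  qed
  show "shift u \<in> flip_symmetries x y" "shift v \<in> flip_symmetries x y"
    using no frame_shift[OF fr] by (auto simp: stitch_isometries_def)
qed

text \<open>A colour-reversing mirror followed by a colour-reversing translation perpendicular to
  its axis is a parallel mirror that preserves colours.\<close>

lemma diagonal_mirror_symmetry:
  assumes m: "grid_map True s s a b \<in> stitch_isometries x y" "mirror (grid_map True s s a b)"
    and s: "s \<in> {1, - 1}"
    and v: "shift (k, - of_int s * k) \<in> flip_symmetries x y"
  shows "\<exists>m\<in>symmetries x y. mirror m \<and> (\<exists>a b. m = grid_map True s s a b)"
proof (cases "grid_map True s s a b \<in> symmetries x y")
  case False
  then have F: "grid_map True s s a b \<in> flip_symmetries x y" using m(1) by (simp add: stitch_isometries_def)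
  have "shift (k, - of_int s * k) \<in> stitch_isometries x y" using v by (simp add: stitch_isometries_def)
  then obtain c d where cd: "(k, - of_int s * k) = (real_of_int c, real_of_int d)" by (rule shift_isometriesE)
  then have "real_of_int d = of_int (- s * c)" by auto
  then have d: "d = - s * c" by (simp only: of_int_eq_iff)
  have "shift (k, - of_int s * k) \<circ> grid_map True s s a b \<in> symmetries x y"
    using v F by (rule symmetries_comp(4))
  moreover have "shift (k, - of_int s * k) \<circ> grid_map True s s a b = grid_map True s s (a + c) (b + d)"
    unfolding cd shift_grid_map by (simp add: grid_map_comp)
  moreover have "mirror (grid_map True s s (a + c) (b + d))"
    using m(2) s by (auto simp: mirror_grid_map d)
  ultimately show ?thesis by metis
qed (use m in blast)

text \<open>Where \<open>diagonal_centre\<close> gives no axis-parallel mirror, it still gives a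
  reversal of \<open>x\<close>. The diagonal flip supplies a shift of \<open>y\<close> of matching
  parity, and the two combine to a reflection or glide with vertical axis.\<close>

lemma axis_isometry:
  assumes "sym_cond x y e True 1 1 a b" "sym_cond x y e' True (- 1) (- 1) a' b'"
    and "shift (h, h) \<in> flip_symmetries x y"
  shows "\<exists>s c d. s \<in> {1, - 1} \<and> grid_map False s (- s) c d \<in> stitch_isometries x y"
proof -
  from diagonal_centre[OF assms(1,2)] show ?thesis
  proof (elim conjE disjE exE)
    assume "has_axis_mirror x y"
    then show ?thesis unfolding has_axis_mirror_def stitch_isometries_def by blast
  next
    fix c assume c: "agree (- 1) x x c c"
    have "shift (h, h) \<in> stitch_isometries x y" using assms(3) by (simp add: stitch_isometries_def)
    then obtain k l where kl: "(h, h) = (real_of_int k, real_of_int l)" by (rule shift_isometriesE)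
    then have "l = k" by simp
    then have "grid_map False 1 1 k k \<in> flip_symmetries x y"
      using assms(3) unfolding kl shift_grid_map by simp
    then have "agree 1 y y k (k + 1)"
      by (simp add: grid_map_symmetries sym_cond_def turn_def)
    moreover have "even (k + 1 - (c + (c + k) + turn (- 1)))" by (simp add: turn_def)
    ultimately have "agree 1 y y k (c + (c + k) + turn (- 1))" using agree_parity by blast
    moreover have "even (c - (k + (c + k) + turn 1))" by (simp add: turn_def)
    then have "agree (- 1) x x c (k + (c + k) + turn 1)" using c agree_parity by blast
    ultimately have "sym_cond x y (c + k) False (- 1) 1 c k" by (simp add: sym_cond_def)
    then have "grid_map False (- 1) 1 c k \<in> stitch_isometries x y"
      using grid_map_isometries[of "- 1"] unit_signs_simps by blast
    then show ?thesis by (intro exI[of _ "- 1"] exI[of _ c] exI[of _ k]) simp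
  qed
qed

text \<open>Two fixed points rule out a half turn; \<open>a + v\<close>, moved while
  \<open>a\<close> is fixed, rules out a translation.\<close>

lemma line_reflection_mirror:
  assumes "line_reflection f"
  shows "mirror f"
proof -
  obtain a v where v: "v \<noteq> 0" and f: "f = (\<lambda>p. p - (2 * ((p - a) \<bullet> v) / (v \<bullet> v)) *\<^sub>R v)"
    using assms unfolding line_reflection_def by blast
  obtain a1 a2 v1 v2 where av: "a = (a1, a2)" "v = (v1, v2)" by fastforce
  define d where "d = v1 * v1 + v2 * v2"
  have d: "d > 0" using v unfolding d_def av zero_prod_def
    by (auto simp: sum_squares_gt_zero_iff)
  have fv: "f (a + t *\<^sub>R v + r *\<^sub>R (- v2, v1)) = a - t *\<^sub>R v + r *\<^sub>R (- v2, v1)" for t r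
  proof -
    have "(a + t *\<^sub>R v + r *\<^sub>R (- v2, v1) - a) \<bullet> v = t * d" by (simp add: av d_def algebra_simps)
    moreover have "v \<bullet> v = d" by (simp add: av d_def)
    ultimately show ?thesis using d by (simp add: f algebra_simps flip: scaleR_add_left)
  qed
  have ff: "f (f p) = p" for p
  proof -
    have "(f p - a) \<bullet> v = - ((p - a) \<bullet> v)" using v by (simp add: f inner_diff_left)
    then have "f (f p) = f p + (2 * ((p - a) \<bullet> v) / (v \<bullet> v)) *\<^sub>R v" by (subst f) simp
    then show ?thesis by (simp add: f)
  qed
  have fa: "f a = a" and f1: "f (a + v) = a - v" and f2: "f (a + (- v2, v1)) = a + (- v2, v1)"
    using fv[of 0 0] fv[of 1 0] fv[of 0 1] by (simp_all flip: zero_prod_def)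
  have "\<not> translation f"
  proof
    assume "translation f"
    then obtain t where "f = shift t" unfolding translation_def by blast
    then have "t = 0" "a + v + t = a - v" using fa f1 by (auto simp: shift_def)
    then show False using v by (auto simp: av zero_prod_def)
  qed
  moreover have "\<not> half_turn f"
  proof
    assume "half_turn f"
    then obtain c where "f = (\<lambda>p. c - p)" unfolding half_turn_def by blast
    then have "c - a = a" "c - (a + (- v2, v1)) = a + (- v2, v1)" using fa f2 by auto
    then show False using v by (cases c) (auto simp: av zero_prod_def)
  qed
  ultimately show ?thesis using ff unfolding mirror_def by (auto simp: fun_eq_iff)
qed

section \<open>Excluded types\<close>

locale typed_pattern =
  fixes x y :: "int \<Rightarrow> int" and T T' :: wallpaper_type
  assumes type: "has_type (symmetries x y \<union> flip_symmetries x y) T"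
    and sym_type: "has_type (symmetries x y) T'"
begin

abbreviation S where "S \<equiv> symmetries x y"
abbreviation F where "F \<equiv> flip_symmetries x y"
abbreviation G where "G \<equiv> stitch_isometries x y"

lemma G_type: "has_type G T"
  using type by (simp only: stitch_isometries_def)

lemma S_subset: "f \<in> S \<Longrightarrow> f \<in> G" and F_subset: "f \<in> F \<Longrightarrow> f \<in> G"
  by (simp_all add: stitch_isometries_def)

text \<open>Signed permutation matrices have order 1, 2 or 4, so an isometry whose cube is the
  identity would be a translation.\<close>

lemma not_hexagonal: "T \<notin> {P31M, P3M1, P6, P6M}"
proof
  assume "T \<in> {P31M, P3M1, P6, P6M}"
  from hexagonal_order_three[OF G_type this]
  obtain f where f: "f \<in> G" "f \<circ> f \<circ> f = id" "f \<noteq> id" by blast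
  obtain e sw s t a b where fm: "f = grid_map sw s t a b"
    and st: "s \<in> {1, - 1}" "t \<in> {1, - 1}" using f(1) by (rule stitch_isometriesE)
  have "f \<circ> f \<circ> f = grid_map False 1 1 0 0" "f \<noteq> grid_map False 1 1 0 0"
    using f(2,3) unfolding grid_map_id by blast+
  then show False
    using st unfolding fm grid_map_comp
    by (elim insertE emptyE; cases sw; simp add: grid_map_comp grid_map_eq_iff)
qed

lemma half_turn_no_mirror:
  assumes "T \<in> {PMM, PMG, PGG, CMM, P4M, P4G, P4}" "T' \<in> {P1, P2, PG, PGG, P4}"
  shows False
proof -
  obtain h f where "h \<in> G" "half_turn h" "f \<in> G" "\<not> translation f" "\<not> half_turn f"
    using has_half_turn[OF G_type assms(1)] by blast
  then obtain m where "m \<in> S" "mirror m" using mirror_of_half_turn by blast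
  then show False using no_mirror[OF sym_type assms(2)] by blast
qed

lemma quarter_turnE:
  assumes "r \<in> G" "half_turn (r \<circ> r)"
  obtains s a b where "s \<in> {1, - 1}" "r = grid_map True s (- s) a b"
proof -
  obtain e sw s t a b where r: "r = grid_map sw s t a b"
    and st: "s \<in> {1, - 1}" "t \<in> {1, - 1}" using assms(1) by (rule stitch_isometriesE)
  have "sw \<and> t = - s"
    using assms(2) st unfolding r grid_map_comp
    by (elim insertE emptyE; cases sw; simp add: translation_grid_map)
  then have "r = grid_map True s (- s) a b" by (simp add: r)
  with st(1) show ?thesis by (rule that)
qed

lemma axis_mirrorE:
  assumes "has_axis_mirror x y"
  obtains m s a b where "m \<in> S" "mirror m" "m = grid_map False s (- s) a b" "s \<in> {1, - 1}"
proof -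
  obtain m where "m \<in> S" "mirror m" "\<exists>s a b. s \<in> {1, - 1} \<and> m = grid_map False s (- s) a b"
    using assms unfolding has_axis_mirror_def by blast
  moreover then obtain s a b where "s \<in> {1, - 1}" "m = grid_map False s (- s) a b" by blast
  ultimately show ?thesis using that by blast
qed

text \<open>A quarter turn forces an axis-parallel mirror, and their product has the linear part of
  a diagonal mirror. By \<open>swap_mirror\<close> the group contains a diagonal mirror too, and the
  pair contradicts \<open>mirrors_commute\<close>.\<close>

lemma not_P4G: "T \<noteq> P4G"
proof
  assume T: "T = P4G"
  obtain r where r: "r \<in> G" "half_turn (r \<circ> r)" using has_quarter_turn[OF G_type] T by blast
  obtain s a b where s: "s \<in> {1, - 1}" and rm: "r = grid_map True s (- s) a b" using r by (rule quarter_turnE)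
  have "has_axis_mirror x y" using quarter_turn_axis_mirror r(1) s unfolding rm by blast
  then obtain m t c d where m: "m \<in> S" "mirror m" "m = grid_map False t (- t) c d" and t: "t \<in> {1, - 1}"
    by (rule axis_mirrorE)
  have ts: "t * s \<in> {1, - 1}" using s t by auto
  have "m \<circ> r \<in> G" using m(1) r(1) by (simp add: S_subset stitch_isometries_comp)
  moreover obtain a' b' where "m \<circ> r = grid_map True (t * s) (t * s) a' b'"
    by (simp add: m(3) rm grid_map_comp)
  ultimately obtain e where "sym_cond x y e True (t * s) (t * s) a' b'"
    using grid_map_isometries[OF sign_unit[OF ts]] by metis
  from swap_mirror[OF this] obtain e' where "sym_cond x y e' True (t * s) (t * s) (- (t * s) * b') b'" by blast
  then have d: "grid_map True (t * s) (t * s) (- (t * s) * b') b' \<in> G" (is "?d \<in> G")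
    using grid_map_isometries[OF sign_unit[OF ts]] by blast
  have "mirror ?d" using mirror_grid_map[OF ts ts] by simp
  then have "translation ((m \<circ> ?d) \<circ> (m \<circ> ?d))"
    using mirrors_commute[OF G_type] T m(1,2) d S_subset by blast
  then show False using t ts by (auto simp: m(3) grid_map_comp translation_grid_map)
qed

lemma mirrorE:
  assumes "m \<in> G" "mirror m"
  obtains (axis) s a b where "m = grid_map False s (- s) a b" "s \<in> {1, - 1}" "m \<in> S"
  | (diagonal) s a b where "m = grid_map True s s a b" "s \<in> {1, - 1}"
proof -
  obtain e sw s t a b where m: "m = grid_map sw s t a b"
    and st: "s \<in> {1, - 1}" "t \<in> {1, - 1}" using assms(1) by (rule stitch_isometriesE)
  have eq: "if sw then t = s else t = - s"
    using assms(2) mirror_grid_map[OF st] unfolding m by (simp split: if_splits)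
  show ?thesis
  proof (cases sw)
    case True
    then show ?thesis using that(2) m eq st(1) by simp
  next
    case False
    then have ma: "m = grid_map False s (- s) a b" and "- s \<in> {1, - 1}" using m eq st by simp_all
    then show ?thesis using that(1) st(1) axis_mirror_symmetry[OF assms ma] by blast
  qed
qed

lemma diagonal_frame_mirror:
  assumes fr: "frame G m u v" and m: "m \<in> G" "mirror m" "m = grid_map True s s a b" and s: "s \<in> {1, - 1}"
  obtains h k m1 a1 b1 where "u = (h, of_int s * h)" "v = (k, - of_int s * k)" "h \<noteq> 0" "k \<noteq> 0"
    "shift u \<in> F" "shift v \<in> F" "m1 \<in> S" "mirror m1" "m1 = grid_map True s s a1 b1"
proof -
  obtain h k where uv: "u = (h, of_int s * h)" "v = (k, - of_int s * k)" "h \<noteq> 0" "k \<noteq> 0"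
    using frame_diagonal[OF fr[unfolded m(3)] s s] by metis
  have F: "shift u \<in> F" "shift v \<in> F" using diagonal_frame_flips[OF fr[unfolded m(3)] s s] by blast+
  have "\<exists>m\<in>S. mirror m \<and> (\<exists>a b. m = grid_map True s s a b)"
    using diagonal_mirror_symmetry[OF _ _ s] m F(2) uv(2) by metis
  then show ?thesis using that uv F by blast
qed

lemma diagonal_flip_other:
  assumes "shift (h, of_int s * h) \<in> F" "s \<in> {1, - 1}"
  shows "shift (h, h) \<in> F" "shift (h, - h) \<in> F" "shift (2 * h, 0) \<in> S"
proof -
  show *: "shift (h, h) \<in> F" "shift (h, - h) \<in> F"
    using assms shift_flip_reflect[of h h x y] shift_flip_reflect[of h "- h" x y] by auto
  have "shift (h, h) \<circ> shift (h, - h) = shift (2 * h, 0)" by (auto simp: shift_def fun_eq_iff)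
  then show "shift (2 * h, 0) \<in> S" using symmetries_comp(4)[OF *] by simp
qed

text \<open>
  In the diagonal case \<open>(2 * h, 0)\<close> preserves colours, being the composition of \<open>(h, h)\<close> and
  \<open>(h, - h)\<close>; a rectangular lattice of colour-preserving translations would contain \<open>(h, \<plusminus>h)\<close> as well.
\<close>

lemma PM_impossible:
  assumes T: "T = PM" and T': "T' \<in> {P1, PG} \<or> T' = PM \<and> (\<exists>f\<in>F. line_reflection f)"
  shows False
proof -
  obtain m u v where m: "m \<in> G" "mirror m" and fr: "frame G m u v"
    and par: "\<And>m'. m' \<in> G \<Longrightarrow> mirror m' \<Longrightarrow> translation (m \<circ> m')"
    using frame_PM G_type T by blast
  have S_mirror: "T' = PM \<and> (\<exists>f\<in>F. line_reflection f)" if "m1 \<in> S" "mirror m1" for m1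
    using T' no_mirror[OF sym_type _ that(1)] that(2) by blast
  from m show False
  proof (cases rule: mirrorE)
    \<comment> \<open>Here \<open>m\<close> preserves colours, so \<open>T'\<close> has mirrors and
      some reflection \<open>f\<close> reverses colours. As all mirrors of pm are parallel,
      \<open>f\<close> is axis-parallel too and cannot reverse colours.\<close>
    case (axis s a b)
    then obtain f where f: "f \<in> F" "line_reflection f" using S_mirror m by blast
    then have f': "f \<in> G" "mirror f" by (simp_all add: F_subset line_reflection_mirror)
    then show False
    proof (cases rule: mirrorE)
      case axis
      then show False using f(1) flip_not_symmetry by blast
    next
      case (diagonal s' a' b')
      then show False using par[OF f'] axis(1)
        by (simp add: grid_map_comp translation_grid_map)
    qed
  next
    case (diagonal s a b)
    obtain h k m1 a1 b1 where uv: "u = (h, of_int s * h)" "v = (k, - of_int s * k)" "h \<noteq> 0" "k \<noteq> 0"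
      and F: "shift u \<in> F" "shift v \<in> F" and m1: "m1 \<in> S" "mirror m1"
      using diagonal_frame_mirror[OF fr m diagonal] by metis
    have "T' = PM" using S_mirror m1 by blast
    then obtain m' u' v' where m': "m' \<in> S" "mirror m'" and fr': "frame S m' u' v'"
      using frame_PM sym_type by blast
    from S_subset[OF m'(1)] m'(2) show False
    proof (cases rule: mirrorE)
      case (axis s' a' b')
      then show False using par[OF S_subset[OF m'(1)] m'(2)] diagonal
        by (simp add: grid_map_comp translation_grid_map)
    next
      case diag': (diagonal s' a' b')
      obtain h' k' where uv': "u' = (h', of_int s' * h')" "v' = (k', - of_int s' * k')"
        using frame_diagonal[OF fr'[unfolded diag'(1)] diag'(2) diag'(2)] by metis
      have "shift (2 * h, 0) \<in> S" using diagonal_flip_other F(1) diagonal(2) uv(1) by blast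
      then obtain i j where ij: "(2 * h, 0) = of_int i *\<^sub>R u' + of_int j *\<^sub>R v'" using frameE[OF fr'] by metis
      then have "2 * h = of_int i * h' + of_int j * k'" "of_int i * h' = of_int j * k'"
        using diag'(2) by (auto simp: uv')
      then have "h = of_int i * h'" by simp
      then have "of_int i *\<^sub>R u' + of_int 0 *\<^sub>R v' = (h, of_int s' * h)" by (simp add: uv')
      then have "shift (h, of_int s' * h) \<in> S" using frame_shift(1)[OF fr', of i 0] by simp
      moreover have "shift (h, of_int s' * h) \<in> F"
        using diagonal_flip_other[of h s] F(1) diagonal(2) uv(1) diag'(2) by auto
      ultimately show False using flip_not_symmetry by blast
    qed
  qed
qed

text \<open>Axis-parallel mirrors preserve colours and generate the group, which leaves no flips. In
  the diagonal position the flip along \<open>u\<close> leads, through \<open>axis_isometry\<close>,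
  to a linear part at 45 degrees to that of \<open>m\<close>, although all linear parts of pmm
  commute.\<close>

lemma PMM_impossible:
  assumes T: "T = PMM" and F: "F \<noteq> {}"
  shows False
proof -
  obtain m u v m' where m: "m \<in> G" "mirror m" and fr: "frame G m u v"
    and m': "m' \<in> G" "mirror m'" "half_turn (m \<circ> m')"
    and par: "\<And>g. g \<in> G \<Longrightarrow> translation ((m \<circ> g) \<circ> (m \<circ> g))"
    using frame_PMM G_type T by blast
  from m show False
  proof (cases rule: mirrorE)
    case (axis s a b)
    have "g \<in> S" if g: "g \<in> G" "mirror g" for g
      using g
    proof (cases rule: mirrorE)
      case (diagonal s' a' b')
      then show ?thesis using par[OF g(1)] axis(1,2)
        by (auto simp: grid_map_comp translation_grid_map)
    qed
    then have "g \<in> S" if "g \<in> G" for g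
      using generated_by_mirrors_PMM[OF G_type[unfolded T] that, of S] symmetries_comp(1) by blast
    then show False using F F_subset flip_not_symmetry by blast
  next
    case (diagonal s a b)
    obtain h k where u: "u = (h, of_int s * h)" and F: "shift u \<in> F"
      using diagonal_frame_mirror[OF fr m diagonal] by metis
    have hh: "shift (h, h) \<in> F" using diagonal_flip_other F diagonal(2) u by blast
    obtain e' sw' s' t' a' b' where m'm: "m' = grid_map sw' s' t' a' b'" using m'(1) by (rule stitch_isometriesE)
    have m'd: "m' = grid_map True (- s) (- s) a' b'"
      using m'(3) diagonal by (auto simp: m'm grid_map_comp translation_grid_map split: if_splits)
    have s: "s \<in> unit_signs" "- s \<in> unit_signs" using diagonal(2) by (auto simp: unit_signs_def)
    obtain e1 e2 where "sym_cond x y e1 True s s a b" "sym_cond x y e2 True (- s) (- s) a' b'"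
      using m(1) m'(1) grid_map_isometries[OF s(1)] grid_map_isometries[OF s(2)]
      unfolding diagonal(1) m'd by blast
    then have "\<exists>s c d. s \<in> {1, - 1} \<and> grid_map False s (- s) c d \<in> G"
      using axis_isometry[OF _ _ hh] diagonal(2) by auto
    then obtain t c d where t: "t \<in> {1, - 1}" "grid_map False t (- t) c d \<in> G" by blast
    then show False using par[OF t(2)] diagonal
      by (auto simp: grid_map_comp translation_grid_map)
  qed
qed

text \<open>In the diagonal position there are colour-preserving mirrors at 45 degrees, against
  \<open>mirrors_commute\<close>. In the axis-parallel position all translations preserve colours,
  so the subgroup has the rectangular lattice of \<open>u\<close> and \<open>v\<close>: this is not
  centred, as \<open>CMM\<close> demands, and has no basis along the diagonals, as
  \<open>P4G\<close> would give.\<close>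

lemma P4M_impossible:
  assumes T: "T = P4M" and T': "T' \<in> {CMM, P4G}"
  shows False
proof -
  obtain m u v m' d where m: "m \<in> G" "mirror m" and fr: "frame G m u v"
    and m': "m' \<in> G" "mirror m'" "half_turn (m \<circ> m')"
    and d: "d \<in> G" "mirror d" "half_turn ((m \<circ> d) \<circ> (m \<circ> d))"
    using frame_P4M G_type T by blast
  from m show False
  proof (cases rule: mirrorE)
    case (diagonal s a b)
    obtain m1 a1 b1 where m1: "m1 \<in> S" "mirror m1" "m1 = grid_map True s s a1 b1"
      using diagonal_frame_mirror[OF fr m diagonal] by metis
    from d(1,2) show False
    proof (cases rule: mirrorE)
      case (axis t c e)
      have "translation ((m1 \<circ> d) \<circ> (m1 \<circ> d))"
        using mirrors_commute[OF sym_type] T' m1(1,2) axis(3) d(2) by blast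
      then show False using diagonal(2) axis(2)
        by (auto simp: m1(3) axis(1) grid_map_comp translation_grid_map)
    next
      case (diagonal t c e)
      then show False using d(3) \<open>m = grid_map True s s a b\<close> \<open>s \<in> {1, - 1}\<close>
        by (auto simp: grid_map_comp translation_grid_map)
    qed
  next
    case (axis s a b)
    obtain e' sw' s' t' a' b' where m'm: "m' = grid_map sw' s' t' a' b'" and st': "s' \<in> {1, - 1}" "t' \<in> {1, - 1}"
      using m'(1) by (rule stitch_isometriesE)
    have m'a: "m' = grid_map False (- s) s a' b'"
      using m'(3) axis(2) st' by (auto simp: m'm axis(1) grid_map_comp translation_grid_map split: if_splits)
    have m'S: "m' \<in> S"
      using axis_mirror_symmetry[OF m'(1,2) m'a] axis(2) by auto
    note uv = frame_axis[OF fr[unfolded axis(1)] axis(2)]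
    \<comment> \<open>As \<open>p\<close> is perpendicular to the axis of \<open>n\<close>, the map
      \<open>n \<circ> shift p\<close> is again an axis-parallel mirror and preserves colours;
      composing with \<open>n\<close> once more recovers \<open>shift p\<close>.\<close>
    have absorb: "shift p \<in> S"
      if p: "shift p \<in> G" and n: "n \<in> S" "n = grid_map False r (- r) k l" "r \<in> {1, - 1}" "mirror n"
        "if r = 1 then fst p = 0 else snd p = 0" for p n r k l
    proof -
      obtain e c d where cd: "p = (real_of_int c, real_of_int d)" using p by (rule shift_isometriesE)
      have np: "n \<circ> shift p = grid_map False r (- r) (r * c + k) (- r * d + l)"
        unfolding cd shift_grid_map by (simp add: n(2) grid_map_comp)
      have r: "- r \<in> {1, - 1}" using n(3) by auto
      have "mirror (n \<circ> shift p)"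
        using n(4)[unfolded n(2) mirror_grid_map[OF n(3) r]] n(3,5)
        unfolding np mirror_grid_map[OF n(3) r] by (auto simp: cd split: if_splits)
      moreover have "n \<circ> shift p \<in> G" using n(1) p by (simp add: S_subset stitch_isometries_comp)
      ultimately have "n \<circ> shift p \<in> S" using axis_mirror_symmetry[OF _ _ np n(3) r] by blast
      then have "n \<circ> (n \<circ> shift p) \<in> S" using n(1) by (simp add: symmetries_comp)
      moreover have "n \<circ> (n \<circ> shift p) = shift p"
        using n(4) unfolding mirror_def by (simp add: o_assoc)
      ultimately show ?thesis by simp
    qed
    have vS: "shift (of_int j *\<^sub>R v) \<in> S" for j
    proof (rule absorb)
      show "shift (of_int j *\<^sub>R v) \<in> G" using frame_shift(1)[OF fr, of 0 j] by simp
      show "m \<in> S" "m = grid_map False s (- s) a b" "s \<in> {1, - 1}" "mirror m" using axis m by blast+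
      show "if s = 1 then fst (of_int j *\<^sub>R v) = 0 else snd (of_int j *\<^sub>R v) = 0" using uv by auto
    qed
    have uS: "shift (of_int i *\<^sub>R u) \<in> S" for i
    proof (rule absorb)
      show "shift (of_int i *\<^sub>R u) \<in> G" using frame_shift(1)[OF fr, of i 0] by simp
      show "m' \<in> S" "m' = grid_map False (- s) (- (- s)) a' b'" "- s \<in> {1, - 1}" "mirror m'"
        using m'S m'a m'(2) axis(2) by auto
      show "if - s = 1 then fst (of_int i *\<^sub>R u) = 0 else snd (of_int i *\<^sub>R u) = 0"
        using uv axis(2) by auto
    qed
    show False
      using T'
    proof (elim insertE emptyE)
      assume "T' = CMM"
      then obtain t where t: "shift t \<in> S" and no: "\<And>r. shift r \<in> S \<Longrightarrow> r + r \<noteq> t + (m t - m 0)"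
        using centred_CMM sym_type axis(3) m(2) by blast
      obtain i j where ij: "t = of_int i *\<^sub>R u + of_int j *\<^sub>R v" using frameE[OF fr S_subset[OF t]] .
      have "of_int i *\<^sub>R u + of_int i *\<^sub>R u = t + (m t - m 0)"
      proof (cases "s = 1")
        case True
        then obtain h w where "u = (h, 0)" "v = (0, w)" using uv by auto
        then show ?thesis using True by (simp add: ij axis(1) grid_map_def zero_prod_def)
      next
        case False
        then obtain h w where "u = (0, h)" "v = (w, 0)" using uv by auto
        moreover have "s = - 1" using False axis(2) by simp
        ultimately show ?thesis by (simp add: ij axis(1) grid_map_def zero_prod_def)
      qed
      then show False using no[OF uS] by blast
    next
      assume "T' = P4G"
      then obtain f u' v' where f: "f \<in> S" and fr': "frame S f u' v'" and ht: "half_turn ((m \<circ> f) \<circ> (m \<circ> f))"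
        using frame_P4G sym_type axis(3) m(2) by blast
      obtain e sw p q c k where fm: "f = grid_map sw p q c k" and pq: "p \<in> {1, - 1}" "q \<in> {1, - 1}"
        using S_subset[OF f] by (rule stitch_isometriesE)
      have "sw"
        using ht axis(2) pq unfolding axis(1) fm grid_map_comp
        by (elim insertE emptyE; cases sw; simp add: grid_map_comp translation_grid_map)
      then have fm: "f = grid_map True p q c k" by (simp add: fm)
      obtain h' k' where uv': "u' = (h', of_int p * h')" "v' = (k', - of_int p * k')"
        using frame_diagonal[OF fr'[unfolded fm] pq] by metis
      have "shift v \<in> S" using vS[of 1] by simp
      then obtain i j where ij: "v = of_int i *\<^sub>R u' + of_int j *\<^sub>R v'" using frameE[OF fr'] by metis
      have "shift (of_int i *\<^sub>R u') \<in> G" using frame_shift(1)[OF fr', of i 0] S_subset by simp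
      then obtain i2 j2 where ij2: "of_int i *\<^sub>R u' = of_int i2 *\<^sub>R u + of_int j2 *\<^sub>R v" using frameE[OF fr] by metis
      \<comment> \<open>The diagonal component \<open>i u'\<close> of \<open>v\<close> has
        coordinate 1/2 along \<open>v\<close>, but as a translation of the pattern it has the
        integral coordinate \<open>j2\<close>.\<close>
      have "\<exists>w. w \<noteq> 0 \<and> w = real_of_int (2 * j2) * w"
      proof (cases "s = 1")
        case True
        then obtain w h where w: "u = (h, 0)" "v = (0, w)" "w \<noteq> 0" using uv by auto
        have "of_int i * h' + of_int j * k' = 0" "of_int p * (of_int i * h') - of_int p * (of_int j * k') = w"
          using ij by (auto simp: w uv' algebra_simps)
        then have "2 * (of_int p * (of_int i * h')) = w"
          using pq(1)
          by (elim insertE emptyE; simp only: of_int_1 of_int_minus mult_1_left mult_minus_left; linarith)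
        moreover have "of_int i * (of_int p * h') = of_int j2 * w" using ij2 by (simp add: w uv')
        then have "of_int p * (of_int i * h') = of_int j2 * w" by (simp only: mult.left_commute)
        ultimately have "w = real_of_int (2 * j2) * w" by simp
        then show ?thesis using w by blast
      next
        case False
        then obtain w h where w: "u = (0, h)" "v = (w, 0)" "w \<noteq> 0" using uv by auto
        have "of_int i * h' + of_int j * k' = w" "of_int p * (of_int i * h') - of_int p * (of_int j * k') = 0"
          using ij by (auto simp: w uv' algebra_simps)
        then have "2 * (of_int i * h') = w" using pq(1) by auto
        moreover have "of_int i * h' = of_int j2 * w"
          using ij2 by (auto simp: w uv' algebra_simps)
        ultimately have "w = real_of_int (2 * j2) * w" by simp
        then show ?thesis using w by blast
      qed
      then have "real_of_int (2 * j2) = real_of_int 1" by auto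
      then have "2 * j2 = 1" by (simp only: of_int_eq_iff)
      then show False by presburger
    qed
  qed
qed

end

section \<open>Realised types\<close>

definition has_flip :: "bool list \<Rightarrow> bool list \<Rightarrow> bool" where
  "has_flip w1 w2 \<longleftrightarrow> (\<exists>g\<in>set point_ops. elements [1] w1 w2 (fst g) (fst (snd g)) (snd (snd g)) \<noteq> [])"

definition bits :: "nat list \<Rightarrow> bool list" where
  "bits = map (\<lambda>k. k = 1)"

lemma matches_range:
  "(a, c) \<in> set (matches s w w') \<Longrightarrow> 0 \<le> a \<and> a < int (length w)"
  by (auto simp: matches_def)

lemma flips_nonempty:
  assumes "has_flip w1 w2" "length w1 > 0" "even (length w1)" "length w2 = length w1"
  shows "flip_symmetries (word w1) (word w2) \<noteq> {}"
proof -
  from assms(1) obtain g where "g \<in> set point_ops"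
    "elements [1] w1 w2 (fst g) (fst (snd g)) (snd (snd g)) \<noteq> []"
    unfolding has_flip_def by blast
  moreover obtain sw s t where "g = (sw, s, t)" by (rule prod_cases3)
  ultimately have st: "s \<in> unit_signs" "t \<in> unit_signs" and "elements [1] w1 w2 sw s t \<noteq> []"
    by (simp_all add: set_point_ops)
  then obtain a b where ab: "(a, b) \<in> set (elements [1] w1 w2 sw s t)"
    by (metis last_in_set surj_pair)
  then have "0 \<le> a \<and> a < int (length w1)" "0 \<le> b \<and> b < int (length w2)"
    unfolding elements_def set_match_pairs using matches_range by blast+
  then have "a mod int (length w1) = a" "b mod int (length w1) = b"
    using assms(4) by simp_all
  then have "sym_cond (word w1) (word w2) 1 sw s t a b"
    using elements_iff[OF refl assms(4,2,3) st, of "[1]" sw a b] ab by (simp only: list.set bex_simps simp_thms)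
  then show ?thesis unfolding flip_symmetries_eq by blast
qed

text \<open>\<open>M\<close> lists the cell of the whole group row by row, the columns being the
  basis vectors, and \<open>c\<close> is the origin in half units; \<open>M'\<close> and
  \<open>c'\<close> do the same for the colour-preserving subgroup. In the instances, words are
  repeated to reach a common even length or the divisibility in \<open>good_frame\<close>.\<close>

lemma compatible_certified:
  assumes "certifies M c [0, 1] T w1 w2" "certifies M' c' [0] T' w1 w2" "has_flip w1 w2"
  shows "compatible (Two_Colour T T')"
proof -
  have w: "length w1 > 0" "even (length w1)" "length w2 = length w1"
    using assms(1) unfolding certifies_def by blast+
  then have "w1 \<noteq> []" "w2 \<noteq> []" by auto
  then have "periodic_binary_word (word w1)" "periodic_binary_word (word w2)"
    by (simp_all add: periodic_word)
  moreover have "flip_symmetries (word w1) (word w2) \<noteq> {}"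
    using assms(3) w by (rule flips_nonempty)
  moreover have "has_two_colour_type (symmetries (word w1) (word w2))
      (flip_symmetries (word w1) (word w2)) (Two_Colour T T')"
    using certifies_has_type[OF assms(1)] certifies_has_type[OF assms(2)]
    by (simp add: stitch_group_simps)
  ultimately show ?thesis unfolding compatible_def by blast
qed

text \<open>For constant words the shifts by \<open>(1, 1)\<close> and \<open>(1, - 1)\<close>
  reverse colours, so the cell of the subgroup has twice the area.\<close>

lemma compatible_P4M_P4M: "compatible (Two_Colour P4M P4M)"
  by (rule compatible_certified
      [of "(- 1, - 1, - 1, 1)" "(1, 1)" _
        "(bits [0, 0])"
        "(bits [0, 0])"
        "(2, 0, 0, 2)" "(1, 1)"]; code_simp)

lemma compatible_PMG_PMG: "compatible (Two_Colour PMG PMG)"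
  by (rule compatible_certified
      [of "(2, 0, 0, 1)" "(0, 0)" _
        "(bits [0, 0])"
        "(bits [0, 1])"
        "(2, 0, 0, 2)" "(0, 1)"]; code_simp)

lemma compatible_CMM_PMG: "compatible (Two_Colour CMM PMG)"
  by (rule compatible_certified
      [of "(- 1, - 1, - 1, 1)" "(0, 0)" _
        "(bits [0, 1])"
        "(bits [0, 1])"
        "(- 1, - 1, 1, - 1)" "(0, 1)"]; code_simp)

lemma compatible_PMG_PM: "compatible (Two_Colour PMG PM)"
  by (rule compatible_certified
      [of "(2, 0, 0, 4)" "(0, 2)" _
        "(bits [0, 0, 0, 0])"
        "(bits [0, 0, 0, 1])"
        "(2, 0, 0, 4)" "(1, 0)"]; code_simp)

lemma compatible_P2_P2: "compatible (Two_Colour P2 P2)"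
  by (rule compatible_certified
      [of "(0, 4, 1, 0)" "(2, 0)" _
        "(bits [0, 0, 0, 1])"
        "(bits [0, 1, 0, 1])"
        "(0, 4, 2, 0)" "(2, 1)"]; code_simp)

lemma compatible_CMM_CM: "compatible (Two_Colour CMM CM)"
  by (rule compatible_certified
      [of "(4, 4, 4, - 4)" "(2, 2)" _
        "(bits (concat (replicate 2 [0, 0, 0, 1])))"
        "(bits (concat (replicate 2 [0, 0, 0, 1])))"
        "(4, 4, - 4, 4)" "(0, 0)"]; code_simp)

text \<open>Both groups have the same conventional cell: the centring translation
  \<open>(1, 3)\<close> reverses colours.\<close>

lemma compatible_CMM_PMM: "compatible (Two_Colour CMM PMM)"
  by (rule compatible_certified
      [of "(2, 0, 0, 6)" "(1, 1)" _
        "(bits [0, 0, 0, 0, 0, 0])"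
        "(bits [0, 0, 1, 0, 0, 1])"
        "(2, 0, 0, 6)" "(1, 1)"]; code_simp)

lemma compatible_P2_P1: "compatible (Two_Colour P2 P1)"
  by (rule compatible_certified
      [of "(0, 6, 6, 0)" "(4, 2)" _
        "(bits [0, 0, 0, 0, 0, 1])"
        "(bits [0, 0, 0, 1, 0, 1])"
        "(0, 6, 6, 0)" "(0, 0)"]; code_simp)

text \<open>The second word is the first moved by one place, which makes the diagonal mirrors
  reverse colours. They and the quarter turns are lost in the subgroup, which keeps the
  cell.\<close>

lemma compatible_P4M_PMM: "compatible (Two_Colour P4M PMM)"
  by (rule compatible_certified
      [of "(0, 6, 6, 0)" "(3, 1)" _
        "(bits [0, 0, 0, 0, 1, 1])"
        "(bits [0, 0, 0, 1, 1, 0])"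
        "(0, 6, 6, 0)" "(3, 1)"]; code_simp)

lemma compatible_CM_P1: "compatible (Two_Colour CM P1)"
  by (rule compatible_certified
      [of "(8, 8, - 8, 8)" "(0, 14)" _
        "(bits (concat (replicate 2 [0, 0, 0, 0, 1, 0, 1, 1])))"
        "(bits (concat (replicate 2 [0, 0, 0, 1, 0, 1, 1, 0])))"
        "(8, 0, 0, 8)" "(0, 0)"]; code_simp)

lemma compatible_P1_P1: "compatible (Two_Colour P1 P1)"
  by (rule compatible_certified
      [of "(0, 8, 1, 0)" "(0, 0)" _
        "(bits [0, 0, 0, 0, 1, 0, 1, 1])"
        "(bits (concat (replicate 4 [0, 1])))"
        "(0, 8, 2, 0)" "(0, 0)"]; code_simp)

lemma compatible_CM_PM: "compatible (Two_Colour CM PM)"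
  by (rule compatible_certified
      [of "(2, 0, 0, 14)" "(1, 0)" _
        "(bits (concat (replicate 14 [1])))"
        "(bits (concat (replicate 2 [1, 1, 0, 1, 0, 0, 1])))"
        "(2, 0, 0, 14)" "(1, 0)"]; code_simp)

text \<open>In each period the second half is the complement of the first, so \<open>(6, 6)\<close>
  and \<open>(6, - 6)\<close> reverse colours, as a diagonal rectangular lattice demands. Equal
  words provide the diagonal mirror.\<close>

lemma compatible_PM_CM: "compatible (Two_Colour PM CM)"
  by (rule compatible_certified
      [of "(6, - 6, - 6, - 6)" "(0, 0)" _
        "(bits (concat (replicate 2 [1, 0, 1, 1, 1, 0, 0, 1, 0, 0, 0, 1])))"
        "(bits (concat (replicate 2 [1, 0, 1, 1, 1, 0, 0, 1, 0, 0, 0, 1])))"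
        "(12, 12, - 12, 12)" "(0, 0)"]; code_simp)

lemma compatible_PG_PG: "compatible (Two_Colour PG PG)"
  by (rule compatible_certified
      [of "(0, 14, 1, 0)" "(0, 0)" _
        "(bits (concat (replicate 2 [0, 0, 0, 1, 1, 0, 1])))"
        "(bits (concat (replicate 7 [0, 1])))"
        "(0, 14, 2, 0)" "(0, 1)"]; code_simp)

lemma compatible_PG_P1: "compatible (Two_Colour PG P1)"
  by (rule compatible_certified
      [of "(6, 0, 0, 12)" "(5, 0)" _
        "(bits (concat (replicate 2 [0, 0, 1, 0, 1, 1])))"
        "(bits [1, 0, 1, 1, 1, 0, 0, 1, 0, 0, 0, 1])"
        "(6, 0, 0, 12)" "(0, 0)"]; code_simp)

text \<open>The words are complementary, so exchanging the coordinates reverses colours. A shift by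
  7 complements each word, so \<open>(7, 0)\<close> reverses colours as well, and its composition
  with the exchange is a colour-preserving glide.\<close>

lemma compatible_CM_PG: "compatible (Two_Colour CM PG)"
  by (rule compatible_certified
      [of "(- 7, 7, 7, 7)" "(0, 0)" _
        "(bits [0, 0, 0, 0, 1, 0, 0, 1, 1, 1, 1, 0, 1, 1])"
        "(bits [1, 1, 1, 1, 0, 1, 1, 0, 0, 0, 0, 1, 0, 0])"
        "(- 7, 7, 7, 7)" "(0, 7)"]; code_simp)

lemma (in typed_pattern) excluded_types:
  assumes "flip_symmetries x y \<noteq> {}"
  shows "T \<notin> {PMM, P4G, P31M, P3M1, P6, P6M}"
    and "\<not> (T \<in> {PMG, PGG, CMM, P4M, P4} \<and> T' \<in> {P1, P2, PG, PGG, P4})"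
    and "\<not> (T = PM \<and> T' \<in> {P1, PG})"
    and "\<not> (T = P4M \<and> T' \<in> {CMM, P4G})"
  using assms not_hexagonal not_P4G PMM_impossible PM_impossible P4M_impossible half_turn_no_mirror
  by blast+

lemma incompatible_PM_PM_m': "\<not> compatible PM_PM_m'"
proof
  assume "compatible PM_PM_m'"
  then obtain x y where "typed_pattern x y PM PM" "\<exists>f\<in>flip_symmetries x y. line_reflection f"
    unfolding compatible_def typed_pattern_def by auto
  then show False using typed_pattern.PM_impossible by blast
qed

text \<open>The certificate fixes the types of the two groups; that no flip is a reflection follows
  from \<open>PM_impossible\<close>.\<close>

lemma compatible_PM_PM_m: "compatible PM_PM_m"
proof -
  let ?v = "bits [0, 0, 0, 0, 1, 1]" and ?w = "bits [0, 0, 0, 1, 1, 1]"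
  have "compatible (Two_Colour PM PM)"
    by (rule compatible_certified[of "(6, 0, 0, 3)" "(3, 0)" _ ?v ?w "(6, 0, 0, 6)" "(3, 0)"]; code_simp)
  then obtain x y where xy: "periodic_binary_word x" "periodic_binary_word y" "flip_symmetries x y \<noteq> {}"
    and types: "has_type (symmetries x y \<union> flip_symmetries x y) PM" "has_type (symmetries x y) PM"
    unfolding compatible_def by auto
  interpret typed_pattern x y PM PM using types by unfold_locales
  have "\<not> (\<exists>f\<in>flip_symmetries x y. line_reflection f)" using PM_impossible by blast
  then show ?thesis using xy types unfolding compatible_def by auto
qed

lemma compatible_two_colour_types:
  "{\<tau> \<in> two_colour_types. compatible \<tau>} =
    {Two_Colour P1 P1, Two_Colour P2 P1, Two_Colour P2 P2,
     PM_PM_m, Two_Colour PM CM,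
     Two_Colour PG P1, Two_Colour PG PG,
     Two_Colour PMG PM, Two_Colour PMG PMG,
     Two_Colour CM PM, Two_Colour CM PG, Two_Colour CM P1,
     Two_Colour CMM PMM, Two_Colour CMM PMG, Two_Colour CMM CM,
     Two_Colour P4M PMM, Two_Colour P4M P4M}" (is "?l = ?r")
proof
  \<comment> \<open>Of the 46 types the four clauses exclude 14, 10, 2 and 2; the one other excluded
    type is \<open>PM_PM_m'\<close>.\<close>
  have "T \<notin> {PMM, P4G, P31M, P3M1, P6, P6M}
      \<and> \<not> (T \<in> {PMG, PGG, CMM, P4M, P4} \<and> T' \<in> {P1, P2, PG, PGG, P4})
      \<and> \<not> (T = PM \<and> T' \<in> {P1, PG}) \<and> \<not> (T = P4M \<and> T' \<in> {CMM, P4G})"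
    if "compatible (Two_Colour T T')" for T T'
  proof -
    from that obtain x y where "typed_pattern x y T T'" "flip_symmetries x y \<noteq> {}"
      unfolding compatible_def typed_pattern_def by auto
    from typed_pattern.excluded_types[OF this] show ?thesis by blast
  qed
  note excluded = this
  show "?l \<subseteq> ?r"
  proof
    fix \<tau> assume "\<tau> \<in> ?l"
    then have "\<tau> \<in> two_colour_types" and c: "compatible \<tau>" by blast+
    then show "\<tau> \<in> ?r"
      unfolding two_colour_types_def
      by (elim insertE emptyE) (use c excluded incompatible_PM_PM_m' in \<open>simp_all, fastforce+\<close>)
  qed
  show "?r \<subseteq> ?l"
    by (simp add: two_colour_types_def compatible_PM_PM_m 
        compatible_P4M_P4M compatible_PMG_PMG compatible_CMM_PMG compatible_PMG_PM compatible_P2_P2 compatible_CMM_CM compatible_CMM_PMM compatible_P2_P1 compatible_P4M_PMM compatible_CM_P1 compatible_P1_P1 compatible_CM_PM compatible_PM_CM compatible_PG_PG compatible_PG_P1 compatible_CM_PG)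
qed

theorem theorem4p17:
  "card two_colour_types = 46 \<and>
   card {\<tau> \<in> two_colour_types. compatible \<tau>} = 17 \<and>
   {\<tau> \<in> two_colour_types. compatible \<tau>} =
    {Two_Colour P1 P1, Two_Colour P2 P1, Two_Colour P2 P2,
     PM_PM_m, Two_Colour PM CM,
     Two_Colour PG P1, Two_Colour PG PG,
     Two_Colour PMG PM, Two_Colour PMG PMG,
     Two_Colour CM PM, Two_Colour CM PG, Two_Colour CM P1,
     Two_Colour CMM PMM, Two_Colour CMM PMG, Two_Colour CMM CM,
     Two_Colour P4M PMM, Two_Colour P4M P4M}"
proof (intro conjI)
  show "card two_colour_types = 46"
    by (simp add: two_colour_types_def)
qed (simp_all add: compatible_two_colour_types)

end
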